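(* Let $r\ge 1$ and let $\mathbf m=(m_1,\dots,m_r)\in\mathcal M_r$ be a Motzkin path. Let $T_{\mathbf m}$ be the transfer matrix of the weighted graph $\Gamma_{\mathbf m}$ and $T'_{\mathbf m}$ the $(r+1)\times(r+1)$ transfer matrix of the compactified weighted graph $\Gamma'_{\mathbf m}$. Then, as formal power series in $t$, $$\big((I-T_{\mathbf m})^{-1}\big)_{1,1}=\big((I-T'_{\mathbf m})^{-1}\big)_{1,1}.$$ That is, the partition function of weighted paths from vertex $1$ to vertex $1$ on $\Gamma_{\mathbf m}$ equals that of weighted paths from vertex $1$ to vertex $1$ on $\Gamma'_{\mathbf m}$.
   Context: Motzkin paths: $\mathcal M_r$ is the set of integer vectors $\mathbf m=(m_1,\dots,m_r)$ with $|m_\alpha-m_{\alpha+1}|\le 1$ for $1\le\alpha<r$ and $\min_\alpha m_\alpha=0$. $Q$-system: $\{R_{\alpha,n}\}_{0\le\alpha\le r+1,n\in\mathbb Z}$ is the solution of $R_{\alpha,n+1}R_{\alpha,n-1}=R_{\alpha,n}^2+R_{\alpha+1,n}R_{\alpha-1,n}$ ($1\le\alpha\le r$), $R_{0,n}=R_{r+1,n}=1$, with initial data $R_{\alpha,0},R_{\alpha,1}$ ($1\le\alpha\le r$) independent indeterminates. Skeleton weights: put $\lambda_{\alpha,n}=R_{\alpha,n+1}/R_{\alpha,n}$ and $\mu_{\alpha,n}=R_{\alpha,n}/R_{\alpha-1,n}$. For $1\le \alpha\le r+1$, $y_{2\alpha-1}(\mathbf m)=\lambda_{\alpha,m_\alpha}/\lambda_{\alpha-1,m_{\alpha-1}}$;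 for $1\le\alpha\le r$, $y_{2\alpha}(\mathbf m)=\frac{\mu_{\alpha+1,m_\alpha+1}}{\mu_{\alpha,m_\alpha}}\,A_\alpha B_\alpha$, where $A_\alpha=\lambda_{\alpha+1,m_{\alpha+1}}/\lambda_{\alpha+1,m_\alpha}$ if $m_\alpha=m_{\alpha+1}+1$ and $A_\alpha=1$ otherwise, and $B_\alpha=\lambda_{\alpha-1,m_\alpha}/\lambda_{\alpha-1,m_{\alpha-1}}$ if $m_{\alpha-1}=m_\alpha+1$ and $B_\alpha=1$ otherwise. (Since $\lambda_{0,n}=\lambda_{r+1,n}=1$, the values of $m_0,m_{r+1}$ are irrelevant.) Write $y_j=y_j(\mathbf m)$. Transfer matrix: for a graph with weighted oriented edges, the entry of the transfer matrix in row $b$, column $a$ is the weight of the oriented edge $a\to b$ (and $0$ if there is none). The graph $\widetilde G_k$ ($k\ge 1$) is the tree with $2k+2$ vertices $0,1,2,2',3,3',\dots,k,k',k+1,k+2$ and $2k+1$ edges labelled as follows: edge $1$ is $(0,1)$; edge $2j$ is $(j,j+1)$ for $1\le j\le k$; edge $2j-1$ is $(j,j')$ for $2\le j\le k$; edge $2k+1$ is $(k+1,k+2)$. Definition of $\Gamma_{\mathbf m}$: decompose $\{1,\dots,r\}$ into maximal strings of consecutive indices $\{\alpha_i,\alpha_i+1,\dots,\alpha_{i+1}-1\}$, $i=1,\dots,p$, $\alpha_1=1$, $\alpha_{p+1}=r+1$, along which $\mathbf m$ descends by exactly $1$ at each step ($m_{\alpha_i+j}=m_{\alpha_i}-j$);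 let $k_i=\alpha_{i+1}-\alpha_i\ge 1$. Between consecutive strings the separation is either flat ($m_{\alpha_{i+1}}=m_{\alpha_{i+1}-1}$) or ascending ($m_{\alpha_{i+1}}=m_{\alpha_{i+1}-1}+1$). Let $\Gamma_{\mathbf m_i}$ be $\widetilde G_{k_i}$ together with additional oriented edges $a\to b$ for all integers $a,b$ with $b\ge 1$, $b+2\le a\le k_i+1$. Glue $\Gamma_{\mathbf m_{i}}$ to $\Gamma_{\mathbf m_{i+1}}$ for $i=1,\dots,p-1$: if the separation is flat, identify vertex $0$ (resp. $1$) of $\Gamma_{\mathbf m_{i+1}}$ with vertex $k_i+2$ (resp. $k_i+1$) of $\Gamma_{\mathbf m_i}$; if ascending, identify vertex $0$ (resp. $1$) of $\Gamma_{\mathbf m_{i+1}}$ with vertex $k_i+1$ (resp. $k_i+2$) of $\Gamma_{\mathbf m_i}$; in both cases the edge $(0,1)$ of $\Gamma_{\mathbf m_{i+1}}$ is identified with the edge $(k_i+1,k_i+2)$ of $\Gamma_{\mathbf m_i}$. The result is $\Gamma_{\mathbf m}$; its root (vertex $0$) and its vertex $1$ are the vertices $0$ and $1$ of $\Gamma_{\mathbf m_1}$. Its skeleton (the union of the $\widetilde G_{k_i}$) is a tree with $2r+2$ vertices and $2r+1$ edges; the edge labelled $j$ in $\widetilde G_{k_i}$ gets label $j+2(\alpha_i-1)$ in $\Gamma_{\mathbf m}$. Each skeleton edge with label $j$ is regarded as two oriented edges: the one pointing toward the root has weight $t\,y_j$, the one pointing away from the root has weight $1$. An additional edge $a\to b$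 of $\Gamma_{\mathbf m_i}$ has weight $t\,\prod_{b\le c<a}w_{c+1,c}\big/\prod_{b<c<a}w_{c',c}$, where $w_{c+1,c}$ and $w_{c',c}$ denote the weights $y_j$ attached to the skeleton edges $(c,c+1)$ and $(c,c')$ of $\Gamma_{\mathbf m_i}$. Definition of $\Gamma'_{\mathbf m}$: vertices $1,\dots,r+1$; oriented edges $i\to i+1$ with weight $1$ and $i+1\to i$ with weight $t y_{2i}$ ($1\le i\le r$); loops $i\to i$ with weight $t y_{2i-1}$ ($1\le i\le r+1$). In addition: for every maximal descending segment of $\mathbf m$ of length $i\ge 2$ (maximal set of consecutive indices $\alpha,\alpha+1,\dots,\alpha+i-1$ with $m_{\alpha+j}=m_\alpha-j$), add edges $\alpha+p\to\alpha+q$ for all $0\le q$, $q+2\le p\le i$, with weight $t\,\prod_{j=\alpha+q}^{\alpha+p-1}y_{2j}\big/\prod_{j=\alpha+q+1}^{\alpha+p-1}y_{2j-1}$; for every maximal ascending segment of length $i\ge2$ (maximal set of consecutive indices $\alpha,\dots,\alpha+i-1$ with $m_{\alpha+j}=m_\alpha+j$), add edges $\alpha+q\to\alpha+p$ for all $0\le q$, $q+2\le p\le i$, with weight $(-1)^{p-q-1}$. *)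

theory Defs
  imports
    "HOL-Analysis.Infinite_Sum"
    "HOL-Library.Poly_Mapping"
    "HOL-Computational_Algebra.Fraction_Field"
    "HOL-Computational_Algebra.Formal_Power_Series"
    "Jordan_Normal_Form.Matrix"
begin

section \<open>Motzkin paths and the Q-system\<close>

text \<open>A path is a function on the naturals of which only the values at \<open>1, \<dots>, r\<close> matter.\<close>

definition motzkin :: "nat \<Rightarrow> (nat \<Rightarrow> int) \<Rightarrow> bool" where
  "motzkin r m \<longleftrightarrow>
     (\<forall>\<alpha>. 1 \<le> \<alpha> \<and> \<alpha> < r \<longrightarrow> \<bar>m \<alpha> - m (\<alpha> + 1)\<bar> \<le> 1) \<and> Min (m ` {1..r}) = 0"

text \<open>Rational functions over \<open>'k\<close> in countably many indeterminates \<open>indet 0, indet 1, \<dots>\<close>: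
  the fraction field of the ring of polynomials, a polynomial being a finitely supported map from
  exponent vectors to coefficients.\<close>

type_synonym 'k ratfun = "((nat \<Rightarrow>\<^sub>0 nat) \<Rightarrow>\<^sub>0 'k) fract"

definition indet :: "nat \<Rightarrow> 'k::field_char_0 ratfun" where
  "indet i = Fract (Poly_Mapping.single (Poly_Mapping.single i 1) 1) 1"

text \<open>The initial data \<open>R \<alpha> 0\<close>, \<open>R \<alpha> 1\<close> for \<open>1 \<le> \<alpha> \<le> r\<close> are pairwise distinct indeterminates.\<close>

definition Q_system :: "nat \<Rightarrow> (nat \<Rightarrow> int \<Rightarrow> 'k::field_char_0 ratfun) \<Rightarrow> bool" where
  "Q_system r R \<longleftrightarrow>
     (\<forall>\<alpha> n. 1 \<le> \<alpha> \<and> \<alpha> \<le> r \<longrightarrow>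
        R \<alpha> (n + 1) * R \<alpha> (n - 1) = (R \<alpha> n)^2 + R (\<alpha> + 1) n * R (\<alpha> - 1) n) \<and>
     (\<forall>n. R 0 n = 1 \<and> R (r + 1) n = 1) \<and>
     (\<forall>\<alpha>. 1 \<le> \<alpha> \<and> \<alpha> \<le> r \<longrightarrow> R \<alpha> 0 = indet (2 * \<alpha>) \<and> R \<alpha> 1 = indet (2 * \<alpha> + 1))"

section \<open>Skeleton weights\<close>

definition lam :: "(nat \<Rightarrow> int \<Rightarrow> 'a::field) \<Rightarrow> nat \<Rightarrow> int \<Rightarrow> 'a" where
  "lam R \<alpha> n = R \<alpha> (n + 1) / R \<alpha> n"

definition mu :: "(nat \<Rightarrow> int \<Rightarrow> 'a::field) \<Rightarrow> nat \<Rightarrow> int \<Rightarrow> 'a" where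
  "mu R \<alpha> n = R \<alpha> n / R (\<alpha> - 1) n"

definition y_odd :: "(nat \<Rightarrow> int \<Rightarrow> 'a::field) \<Rightarrow> (nat \<Rightarrow> int) \<Rightarrow> nat \<Rightarrow> 'a" where
  "y_odd R m \<alpha> = lam R \<alpha> (m \<alpha>) / lam R (\<alpha> - 1) (m (\<alpha> - 1))"

definition y_even :: "(nat \<Rightarrow> int \<Rightarrow> 'a::field) \<Rightarrow> (nat \<Rightarrow> int) \<Rightarrow> nat \<Rightarrow> 'a" where
  "y_even R m \<alpha> =
     mu R (\<alpha> + 1) (m \<alpha> + 1) / mu R \<alpha> (m \<alpha>)
     * (if m \<alpha> = m (\<alpha> + 1) + 1
        then lam R (\<alpha> + 1) (m (\<alpha> + 1)) / lam R (\<alpha> + 1) (m \<alpha>) else 1)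
     * (if m (\<alpha> - 1) = m \<alpha> + 1
        then lam R (\<alpha> - 1) (m \<alpha>) / lam R (\<alpha> - 1) (m (\<alpha> - 1)) else 1)"

definition y_wt :: "(nat \<Rightarrow> int \<Rightarrow> 'a::field) \<Rightarrow> (nat \<Rightarrow> int) \<Rightarrow> nat \<Rightarrow> 'a" where
  "y_wt R m j = (if odd j then y_odd R m ((j + 1) div 2) else y_even R m (j div 2))"

section \<open>Weighted oriented graphs\<close>

text \<open>A weighted oriented graph is given by its set of edges \<open>(source, weight, target)\<close>.  In the
  graphs below there is at most one edge from one given vertex to another.\<close>

type_synonym ('v, 'w) wedges = "('v \<times> 'w \<times> 'v) set"

definition edge_wt :: "('v, 'w::zero) wedges \<Rightarrow> 'v \<Rightarrow> 'v \<Rightarrow> 'w" where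
  "edge_wt E a b = (if \<exists>w. (a, w, b) \<in> E then THE w. (a, w, b) \<in> E else 0)"

text \<open>The vertices are ordered by the list \<open>vs\<close>; rows are targets and columns are sources.\<close>

definition transfer_mat :: "'v list \<Rightarrow> ('v, 'w::zero) wedges \<Rightarrow> 'w mat" where
  "transfer_mat vs E =
     mat (length vs) (length vs) (\<lambda>(i, j). edge_wt E (vs ! j) (vs ! i))"

definition mat_inv :: "'a::semiring_1 mat \<Rightarrow> 'a mat" where
  "mat_inv A = (THE B. inverts_mat A B \<and> inverts_mat B A)"

text \<open>The matrix \<open>(I - T)\<^sup>-\<^sup>1\<close>, meaningful when \<open>I - T\<close> is invertible.\<close>

definition resolvent :: "'a::ring_1 mat \<Rightarrow> 'a mat" where
  "resolvent T = mat_inv (1\<^sub>m (dim_row T) - T)"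

text \<open>Paths are nonempty lists of vertices, and their weight is the product of the weights of their
  steps; the sum over paths is taken in the \<open>t\<close>-adic topology of \<open>fps\<close>.\<close>

definition paths :: "('v, 'w) wedges \<Rightarrow> 'v \<Rightarrow> 'v \<Rightarrow> 'v list set" where
  "paths E a b = {p. p \<noteq> [] \<and> hd p = a \<and> last p = b \<and>
                     (\<forall>i. Suc i < length p \<longrightarrow> (\<exists>w. (p ! i, w, p ! Suc i) \<in> E))}"

definition path_wt :: "('v, 'w::comm_semiring_1) wedges \<Rightarrow> 'v list \<Rightarrow> 'w" where
  "path_wt E p = (\<Prod>i<length p - 1. edge_wt E (p ! i) (p ! Suc i))"

section \<open>Monotone segments\<close>

text \<open>\<open>seg r m d \<alpha> i\<close>: along the \<open>i\<close> consecutive indices starting at \<open>\<alpha>\<close> the path changes by \<open>d\<close>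
  at each step; \<open>d\<close> is \<open>-1\<close> for descending and \<open>1\<close> for ascending segments.\<close>

definition seg :: "nat \<Rightarrow> (nat \<Rightarrow> int) \<Rightarrow> int \<Rightarrow> nat \<Rightarrow> nat \<Rightarrow> bool" where
  "seg r m d \<alpha> i \<longleftrightarrow>
     1 \<le> \<alpha> \<and> 1 \<le> i \<and> \<alpha> + i \<le> r + 1 \<and> (\<forall>j<i. m (\<alpha> + j) = m \<alpha> + d * int j)"

definition max_seg :: "nat \<Rightarrow> (nat \<Rightarrow> int) \<Rightarrow> int \<Rightarrow> nat \<Rightarrow> nat \<Rightarrow> bool" where
  "max_seg r m d \<alpha> i \<longleftrightarrow> seg r m d \<alpha> i \<and>
     (\<forall>\<alpha>' i'. seg r m d \<alpha>' i' \<and> {\<alpha>..<\<alpha> + i} \<subseteq> {\<alpha>'..<\<alpha>' + i'} \<longrightarrow> \<alpha>' = \<alpha> \<and> i' = i)"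

section \<open>The graph \<open>\<Gamma>\<^sub>m\<close>\<close>

text \<open>\<open>V j\<close> is the vertex \<open>j\<close> and \<open>P j\<close> is the vertex \<open>j'\<close>.\<close>

datatype gvert = V nat | P nat

definition Gt_verts :: "nat \<Rightarrow> gvert set" where
  "Gt_verts k = V ` {0..k + 2} \<union> P ` {2..k}"

text \<open>Unoriented edges of \<open>G\<^sub>k\<close> (with tilde) as triples \<open>(label, end, end)\<close>.\<close>

definition Gt_edges :: "nat \<Rightarrow> (nat \<times> gvert \<times> gvert) set" where
  "Gt_edges k =
     {(1, V 0, V 1)}
     \<union> {(2 * j, V j, V (j + 1)) | j. 1 \<le> j \<and> j \<le> k}
     \<union> {(2 * j - 1, V j, P j) | j. 2 \<le> j \<and> j \<le> k}
     \<union> {(2 * k + 1, V (k + 1), V (k + 2))}"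

text \<open>The decomposition of \<open>{1..r}\<close> into maximal descending strings, numbered \<open>1, \<dots>, nstr\<close>: string
  \<open>i\<close> starts at \<open>sstart i\<close> and has length \<open>slen i\<close>, and \<open>sstart (nstr + 1) = r + 1\<close>.\<close>

definition starts :: "nat \<Rightarrow> (nat \<Rightarrow> int) \<Rightarrow> nat list" where
  "starts r m = sorted_list_of_set {\<alpha>. \<exists>i. max_seg r m (-1) \<alpha> i}"

definition nstr :: "nat \<Rightarrow> (nat \<Rightarrow> int) \<Rightarrow> nat" where
  "nstr r m = length (starts r m)"

definition sstart :: "nat \<Rightarrow> (nat \<Rightarrow> int) \<Rightarrow> nat \<Rightarrow> nat" where
  "sstart r m i = (starts r m @ [r + 1]) ! (i - 1)"

definition slen :: "nat \<Rightarrow> (nat \<Rightarrow> int) \<Rightarrow> nat \<Rightarrow> nat" where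
  "slen r m i = sstart r m (i + 1) - sstart r m i"

text \<open>Flat separation between the strings \<open>i\<close> and \<open>i + 1\<close>; for a Motzkin path the only other
  possibility is an ascending one.\<close>

definition flat :: "nat \<Rightarrow> (nat \<Rightarrow> int) \<Rightarrow> nat \<Rightarrow> bool" where
  "flat r m i \<longleftrightarrow> m (sstart r m (i + 1)) = m (sstart r m (i + 1) - 1)"

text \<open>\<open>(i, v)\<close> is the vertex \<open>v\<close> of the \<open>i\<close>-th piece.  The gluing identifies vertices \<open>0\<close> and \<open>1\<close> of
  each piece but the first with vertices of the preceding one; \<open>glue\<close> chooses the copy in the
  preceding piece as representative.  As \<open>k + 1 \<ge> 2\<close>, that copy is itself not replaced.\<close>

definition glue :: "nat \<Rightarrow> (nat \<Rightarrow> int) \<Rightarrow> nat \<Rightarrow> gvert \<Rightarrow> nat \<times> gvert" where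
  "glue r m i v =
     (let k = slen r m (i - 1) in
      if 2 \<le> i \<and> v = V 0 then (i - 1, V (if flat r m (i - 1) then k + 2 else k + 1))
      else if 2 \<le> i \<and> v = V 1 then (i - 1, V (if flat r m (i - 1) then k + 1 else k + 2))
      else (i, v))"

definition Gamma_verts :: "nat \<Rightarrow> (nat \<Rightarrow> int) \<Rightarrow> (nat \<times> gvert) set" where
  "Gamma_verts r m = (\<Union>i\<in>{1..nstr r m}. glue r m i ` Gt_verts (slen r m i))"

definition Gamma_root :: "nat \<Rightarrow> (nat \<Rightarrow> int) \<Rightarrow> nat \<times> gvert" where
  "Gamma_root r m = glue r m 1 (V 0)"

definition Gamma_one :: "nat \<Rightarrow> (nat \<Rightarrow> int) \<Rightarrow> nat \<times> gvert" where
  "Gamma_one r m = glue r m 1 (V 1)"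

text \<open>Skeleton edges with their labels, each unoriented edge in both directions.\<close>

definition skel :: "nat \<Rightarrow> (nat \<Rightarrow> int) \<Rightarrow> (nat \<times> (nat \<times> gvert) \<times> (nat \<times> gvert)) set" where
  "skel r m =
     {(l + 2 * (sstart r m i - 1), glue r m i u, glue r m i v) | i l u v.
        1 \<le> i \<and> i \<le> nstr r m \<and> ((l, u, v) \<in> Gt_edges (slen r m i) \<or> (l, v, u) \<in> Gt_edges (slen r m i))}"

definition skel_adj :: "nat \<Rightarrow> (nat \<Rightarrow> int) \<Rightarrow> ((nat \<times> gvert) \<times> (nat \<times> gvert)) set" where
  "skel_adj r m = {(u, v). \<exists>j. (j, u, v) \<in> skel r m}"

text \<open>Distance from the root in the skeleton; an oriented edge of this tree points toward the root
  iff it decreases this distance.\<close>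

definition root_dist :: "nat \<Rightarrow> (nat \<Rightarrow> int) \<Rightarrow> nat \<times> gvert \<Rightarrow> nat" where
  "root_dist r m v = (LEAST n. (Gamma_root r m, v) \<in> skel_adj r m ^^ n)"

text \<open>In the weight of an additional edge of the \<open>i\<close>-th piece, the edge \<open>(c, c+1)\<close> has label \<open>2c\<close> in
  the piece (as \<open>1 \<le> c \<le> k\<close>) and the edge \<open>(c, c')\<close> has label \<open>2c - 1\<close> (as \<open>2 \<le> c \<le> k\<close>); both
  labels are shifted in the glued graph.\<close>

definition Gamma_edges ::
  "nat \<Rightarrow> (nat \<Rightarrow> int) \<Rightarrow> (nat \<Rightarrow> 'a::field) \<Rightarrow> (nat \<times> gvert, 'a fps) wedges" where
  "Gamma_edges r m y =
     {(u, fps_X * fps_const (y j), v) | j u v.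
        (j, u, v) \<in> skel r m \<and> root_dist r m v < root_dist r m u}
     \<union> {(u, 1, v) | j u v. (j, u, v) \<in> skel r m \<and> root_dist r m u < root_dist r m v}
     \<union> {(glue r m i (V a),
         fps_X * fps_const
           ((\<Prod>c\<in>{b..<a}. y (2 * c + 2 * (sstart r m i - 1)))
            / (\<Prod>c\<in>{b<..<a}. y (2 * c - 1 + 2 * (sstart r m i - 1)))),
         glue r m i (V b)) | i a b.
        1 \<le> i \<and> i \<le> nstr r m \<and> 1 \<le> b \<and> b + 2 \<le> a \<and> a \<le> slen r m i + 1}"

section \<open>The compactified graph \<open>\<Gamma>'\<^sub>m\<close>\<close>

definition Gamma'_edges ::
  "nat \<Rightarrow> (nat \<Rightarrow> int) \<Rightarrow> (nat \<Rightarrow> 'a::field) \<Rightarrow> (nat, 'a fps) wedges" where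
  "Gamma'_edges r m y =
     {(i, 1, i + 1) | i. 1 \<le> i \<and> i \<le> r}
     \<union> {(i + 1, fps_X * fps_const (y (2 * i)), i) | i. 1 \<le> i \<and> i \<le> r}
     \<union> {(i, fps_X * fps_const (y (2 * i - 1)), i) | i. 1 \<le> i \<and> i \<le> r + 1}
     \<union> {(\<alpha> + p,
         fps_X * fps_const
           ((\<Prod>j\<in>{\<alpha> + q..\<alpha> + p - 1}. y (2 * j))
            / (\<Prod>j\<in>{\<alpha> + q + 1..\<alpha> + p - 1}. y (2 * j - 1))),
         \<alpha> + q) | \<alpha> i p q. max_seg r m (-1) \<alpha> i \<and> 2 \<le> i \<and> q + 2 \<le> p \<and> p \<le> i}
     \<union> {(\<alpha> + q, (-1) ^ (p - q - 1), \<alpha> + p) | \<alpha> i p q.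
          max_seg r m 1 \<alpha> i \<and> 2 \<le> i \<and> q + 2 \<le> p \<and> p \<le> i}"

end

theory Submission
  imports Defs
begin

text \<open>On both graphs the paths from \<open>u\<close> to \<open>1\<close> are counted by the unique solution of
  \<open>z u = [u = 1] + (\<Sum>v. w(u \<rightarrow> v) z v)\<close>, so it suffices to turn a solution \<open>z'\<close> on \<open>\<Gamma>'\<^sub>m\<close> into one on
  \<open>\<Gamma>\<^sub>m\<close> with the same value at \<open>1\<close>.  Where \<open>m\<close> ascends to \<open>n\<close>, the skeleton edge labelled \<open>2n - 1\<close>
  is not a pendant but separates two vertices \<open>Q n\<close>, \<open>B n\<close> of \<open>\<Gamma>\<^sub>m\<close>, which \<open>\<Gamma>'\<^sub>m\<close> merges into \<open>n\<close>.
  Let \<open>U n\<close> be the contribution of the upward edges out of \<open>n\<close> to \<open>z' n\<close>.  The alternating signs of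
  those edges give \<open>U (n - 1) = z' n - U n\<close>, so \<open>U (n - 1)\<close> collects exactly the loop and the
  downward edges at \<open>n\<close>.  With \<open>\<tau> n\<close> the product of \<open>t y\<^bsub>2l-1\<^esub>\<close> over the ascents \<open>l \<le> n\<close>, the values
  \<open>\<tau> n * z' n\<close> at \<open>B n\<close> and \<open>\<tau> (n - 1) * U (n - 1)\<close> at \<open>Q n\<close> solve the equations on \<open>\<Gamma>\<^sub>m\<close>.\<close>

section \<open>Resolvents of graded graphs\<close>

lemma mat_inv_eqI:
  fixes A B :: "'a::semiring_1 mat"
  assumes A: "A \<in> carrier_mat n n" and B: "B \<in> carrier_mat n n"
    and AB: "A * B = 1\<^sub>m n" and BA: "B * A = 1\<^sub>m n"
  shows "mat_inv A = B"
  unfolding mat_inv_def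
proof (rule the_equality)
  show "inverts_mat A B \<and> inverts_mat B A"
    using assms by (auto simp: inverts_mat_def)
next
  fix C assume C: "inverts_mat A C \<and> inverts_mat C A"
  then have AC: "A * C = 1\<^sub>m n" and CA: "C * A = 1\<^sub>m (dim_row C)"
    using A by (auto simp: inverts_mat_def)
  from arg_cong[OF AC, of dim_col] arg_cong[OF CA, of dim_col] A
  have "C \<in> carrier_mat n n" by (intro carrier_matI) auto
  then have "C = (B * A) * C" by (simp add: BA)
  also have "\<dots> = B * (A * C)" using assoc_mult_mat[OF B A \<open>C \<in> carrier_mat n n\<close>] .
  also have "\<dots> = B" using B by (simp add: AC)
  finally show "C = B" .
qed

lemma sum_nth_distinct:
  assumes "distinct xs"
  shows "(\<Sum>k<length xs. f (xs ! k)) = (\<Sum>v\<in>set xs. f v)"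
  using sum.reindex_bij_betw[OF bij_betw_nth[OF assms refl refl], of f] by simp

lemma sum_if_less:
  fixes F :: "nat \<Rightarrow> 'b::comm_monoid_add"
  shows "n \<in> {1..r + 1} \<Longrightarrow>
    (\<Sum>n'\<in>{1..r + 1}. if n' < n then F n' else 0) = (\<Sum>n'\<in>{1..<n}. F n')"
  by (rule sum.mono_neutral_cong_right) auto

lemma path_wt_Cons:
  "p \<noteq> [] \<Longrightarrow> path_wt E (a # p) = edge_wt E a (hd p) * path_wt E p"
proof -
  assume "p \<noteq> []"
  then obtain n where n: "length p = Suc n" by (cases p) auto
  show ?thesis using \<open>p \<noteq> []\<close>
    unfolding path_wt_def by (simp add: n prod.lessThan_Suc_shift hd_conv_nth del: prod.lessThan_Suc)
qed

lemma Cons_in_paths_iff: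
  "p \<noteq> [] \<Longrightarrow> a' # p \<in> paths E a b \<longleftrightarrow>
     a' = a \<and> (\<exists>w. (a, w, hd p) \<in> E) \<and> p \<in> paths E (hd p) b"
  unfolding paths_def by (cases p) (auto simp: All_less_Suc2 nth_Cons split: nat.splits)

lemma paths_length_1: "{p \<in> paths E a b. length p = Suc 0} = (if a = b then {[a]} else {})"
  by (auto simp: paths_def length_Suc_conv)

text \<open>Covers the unique choice and the default \<open>0\<close> of \<open>edge_wt\<close> at
  once: a closed formula \<open>f\<close> has to name an actual edge only where it is
  nonzero.\<close>

lemma edge_wt_eqI:
  assumes "\<And>w. (a, w, b) \<in> E \<Longrightarrow> w = f" and "f \<noteq> 0 \<Longrightarrow> (a, f, b) \<in> E"
  shows "edge_wt E a b = f"
proof (cases "\<exists>w. (a, w, b) \<in> E")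
  case True
  then obtain w where "(a, w, b) \<in> E" by blast
  with assms(1) have "(a, f, b) \<in> E" by simp
  then have "(THE w. (a, w, b) \<in> E) = f" using assms(1) by (rule the_equality)
  with True show ?thesis by (simp add: edge_wt_def)
next
  case False
  with assms(2) have "f = 0" by blast
  with False show ?thesis by (simp add: edge_wt_def)
qed

text \<open>The edges of order \<open>0\<close> raise a bounded rank, so a path with many steps has high order.\<close>

locale graded_graph =
  fixes S :: "'v set" and E :: "('v, 'a::comm_ring_1 fps) wedges"
    and rk :: "'v \<Rightarrow> nat" and K :: nat
  assumes finite_S: "finite S"
    and edge_in: "(u, w, v) \<in> E \<Longrightarrow> u \<in> S \<and> v \<in> S"
    and rk_less: "fps_nth (edge_wt E u v) 0 \<noteq> 0 \<Longrightarrow> rk u < rk v"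
    and rk_le: "v \<in> S \<Longrightarrow> rk v \<le> K"
begin

lemma edge_wt_outside: "u \<notin> S \<or> v \<notin> S \<Longrightarrow> edge_wt E u v = 0"
  using edge_in by (auto simp: edge_wt_def)

section \<open>Paths with a fixed number of steps\<close>

abbreviation npaths :: "nat \<Rightarrow> 'v \<Rightarrow> 'v \<Rightarrow> 'v list set" where
  "npaths n a b \<equiv> {p \<in> paths E a b. length p = Suc n}"

text \<open>For \<open>a\<close>, \<open>b\<close> in \<open>S\<close> this is the entry of the
  \<open>n\<close>-th power of the transfer matrix in row \<open>b\<close>, column
  \<open>a\<close>.\<close>

definition W :: "nat \<Rightarrow> 'v \<Rightarrow> 'v \<Rightarrow> 'a fps" where
  "W n a b = (\<Sum>p\<in>npaths n a b. path_wt E p)"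

lemma npaths_Suc:
  "npaths (Suc n) a b = (\<Union>x\<in>{x\<in>S. \<exists>w. (a, w, x) \<in> E}. (#) a ` npaths n x b)"
proof (rule Set.set_eqI)
  fix p
  show "p \<in> npaths (Suc n) a b \<longleftrightarrow> p \<in> (\<Union>x\<in>{x\<in>S. \<exists>w. (a, w, x) \<in> E}. (#) a ` npaths n x b)"
  proof (cases p)
    case (Cons a' q)
    show ?thesis
    proof (cases "q = []")
      case False
      then show ?thesis
        using edge_in by (auto simp: Cons Cons_in_paths_iff) (auto simp: paths_def)
    qed (auto simp: Cons)
  qed (auto simp: paths_def)
qed

lemma finite_npaths: "finite (npaths n a b)"
proof (induction n arbitrary: a)
  case 0
  show ?case by (simp add: paths_length_1)
next
  case (Suc n)
  show ?case unfolding npaths_Suc using Suc finite_S by auto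
qed

lemma W_0: "W 0 a b = (if a = b then 1 else 0)"
  by (simp add: W_def paths_length_1 path_wt_def)

lemma W_Suc: "W (Suc n) a b = (\<Sum>x\<in>S. edge_wt E a x * W n x b)"
proof -
  let ?N = "{x\<in>S. \<exists>w. (a, w, x) \<in> E}"
  have "W (Suc n) a b = (\<Sum>x\<in>?N. \<Sum>p\<in>(#) a ` npaths n x b. path_wt E p)"
    unfolding W_def npaths_Suc
    by (rule sum.UNION_disjoint) (use finite_S finite_npaths in \<open>auto simp: paths_def\<close>)
  also have "\<dots> = (\<Sum>x\<in>?N. edge_wt E a x * W n x b)"
    unfolding W_def sum_distrib_left
    by (rule sum.cong[OF refl], subst sum.reindex)
       (auto simp: paths_def path_wt_Cons o_def intro!: sum.cong)
  also have "\<dots> = (\<Sum>x\<in>S. edge_wt E a x * W n x b)"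
    by (rule sum.mono_neutral_left) (use finite_S in \<open>auto simp: edge_wt_def\<close>)
  finally show ?thesis .
qed

text \<open>Splits off the last step instead of the first. As for powers of a matrix, this follows
  from \<open>W_Suc\<close> by induction, with no second decomposition of paths.\<close>

lemma W_Suc': "b \<in> S \<Longrightarrow> W (Suc n) a b = (\<Sum>x\<in>S. W n a x * edge_wt E x b)"
proof (induction n arbitrary: a)
  case 0
  have "W (Suc 0) a b = (\<Sum>x\<in>S. if x = b then edge_wt E a x else 0)"
    unfolding W_Suc W_0 by (intro sum.cong) auto
  also have "\<dots> = edge_wt E a b" using finite_S 0 by (simp add: sum.delta)
  also have "\<dots> = (\<Sum>x\<in>S. if x = a then edge_wt E x b else 0)"
    using finite_S by (simp add: sum.delta edge_wt_outside)
  also have "\<dots> = (\<Sum>x\<in>S. W 0 a x * edge_wt E x b)"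
    unfolding W_0 by (intro sum.cong) auto
  finally show ?case .
next
  case (Suc n)
  have "W (Suc (Suc n)) a b = (\<Sum>x\<in>S. edge_wt E a x * (\<Sum>z\<in>S. W n x z * edge_wt E z b))"
    by (subst W_Suc) (simp add: Suc)
  also have "\<dots> = (\<Sum>x\<in>S. \<Sum>z\<in>S. edge_wt E a x * W n x z * edge_wt E z b)"
    by (simp add: sum_distrib_left mult.assoc)
  also have "\<dots> = (\<Sum>z\<in>S. \<Sum>x\<in>S. edge_wt E a x * W n x z * edge_wt E z b)"
    by (rule sum.swap)
  also have "\<dots> = (\<Sum>z\<in>S. W (Suc n) a z * edge_wt E z b)"
    by (simp add: W_Suc sum_distrib_right)
  finally show ?case .
qed

text \<open>The measure \<open>n + rk a\<close> does not drop along a step with nonzero constant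
  term, since such a step raises the rank. Any other step costs one power of \<open>t\<close> and
  lowers the measure by at most \<open>K + 1\<close>, which is what replacing \<open>j\<close> by
  \<open>j - 1\<close> allows.\<close>

lemma path_wt_order:
  "p \<in> npaths n a b \<Longrightarrow> a \<in> S \<Longrightarrow> n + rk a > j * (K + 1) + K \<Longrightarrow> fps_nth (path_wt E p) j = 0"
proof (induction n arbitrary: p a j)
  case 0
  then show ?case using rk_le[of a] by simp
next
  case (Suc n)
  then obtain x q where x: "x \<in> S" and q: "q \<in> npaths n x b" and p: "p = a # q"
    unfolding npaths_Suc by auto
  have q': "q \<noteq> []" "hd q = x" using q by (auto simp: paths_def)
  have "fps_nth (edge_wt E a x) i * fps_nth (path_wt E q) (j - i) = 0" if "i \<le> j" for i
  proof (cases "i = 0")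
    case True
    show ?thesis
    proof (cases "fps_nth (edge_wt E a x) 0 = 0")
      case False
      with rk_less have "rk a < rk x" by blast
      with Suc.prems have "n + rk x > j * (K + 1) + K" by linarith
      with Suc.IH[OF q x] True show ?thesis by simp
    qed (simp add: True)
  next
    case False
    have "j * (K + 1) + K < Suc n + K" using Suc.prems rk_le[of a] by linarith
    moreover have "(j - i) * (K + 1) + (K + 1) \<le> j * (K + 1)"
      using mult_le_mono1[of "Suc (j - i)" j "K + 1"] False that by (simp only: mult_Suc) linarith
    ultimately have "n + rk x > (j - i) * (K + 1) + K" by linarith
    with Suc.IH[OF q x] show ?thesis by simp
  qed
  then show ?case by (simp add: p path_wt_Cons q' fps_mult_nth)
qed

lemma W_order: "a \<in> S \<Longrightarrow> n > j * (K + 1) + K \<Longrightarrow> fps_nth (W n a b) j = 0"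
  by (auto simp: W_def fps_sum_nth intro!: sum.neutral path_wt_order)

text \<open>The Neumann series of the transfer matrix. Its coefficient at \<open>j\<close> is a
  finite sum, cut off where \<open>W_order\<close> makes all further terms vanish.\<close>

definition G :: "'v \<Rightarrow> 'v \<Rightarrow> 'a fps" where
  "G a b = Abs_fps (\<lambda>j. \<Sum>n\<le>j * (K + 1) + K. fps_nth (W n a b) j)"

lemma G_nth:
  assumes "a \<in> S" and "j * (K + 1) + K \<le> N"
  shows "fps_nth (G a b) j = fps_nth (\<Sum>n\<le>N. W n a b) j"
  unfolding G_def fps_nth_Abs_fps fps_sum_nth
  by (rule sum.mono_neutral_left) (use assms W_order in auto)

lemma G_left:
  assumes a: "a \<in> S"
  shows "G a b = (if a = b then 1 else 0) + (\<Sum>x\<in>S. edge_wt E a x * G x b)"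
proof (rule fps_ext)
  fix j
  let ?N = "j * (K + 1) + K"
  have le: "i * (K + 1) + K \<le> ?N" if "i \<le> j" for i
    using mult_le_mono1[OF that, of "K + 1"] by simp
  \<comment> \<open>One term beyond the bound is taken, so that after splitting off
    \<open>W 0\<close> the shifted sum still runs up to \<open>?N\<close>, which suffices for every
    coefficient up to \<open>j\<close>.\<close>
  have "fps_nth (G a b) j = fps_nth (\<Sum>n\<le>Suc ?N. W n a b) j"
    by (rule G_nth[OF a]) simp
  also have "(\<Sum>n\<le>Suc ?N. W n a b) = (if a = b then 1 else 0)
      + (\<Sum>x\<in>S. edge_wt E a x * (\<Sum>n\<le>?N. W n x b))"
    unfolding sum.atMost_Suc_shift W_0 W_Suc sum_distrib_left by (subst sum.swap) simp
  also have "fps_nth \<dots> j = fps_nth ((if a = b then 1 else 0)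
      + (\<Sum>x\<in>S. edge_wt E a x * G x b)) j"
    unfolding fps_add_nth fps_sum_nth fps_mult_nth
    by (intro arg_cong2[where f = "(+)"] sum.cong refl) (auto simp: G_nth[OF _ le] simp flip: fps_sum_nth)
  finally show "fps_nth (G a b) j = \<dots>" .
qed

lemma G_right:
  assumes a: "a \<in> S" and b: "b \<in> S"
  shows "G a b = (if a = b then 1 else 0) + (\<Sum>x\<in>S. G a x * edge_wt E x b)"
proof (rule fps_ext)
  fix j
  let ?N = "j * (K + 1) + K"
  have le: "i * (K + 1) + K \<le> ?N" if "i \<le> j" for i
    using mult_le_mono1[OF that, of "K + 1"] by simp
  have "fps_nth (G a b) j = fps_nth (\<Sum>n\<le>Suc ?N. W n a b) j"
    by (rule G_nth[OF a]) simp
  also have "(\<Sum>n\<le>Suc ?N. W n a b) = (if a = b then 1 else 0)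
      + (\<Sum>x\<in>S. (\<Sum>n\<le>?N. W n a x) * edge_wt E x b)"
    unfolding sum.atMost_Suc_shift W_0 W_Suc'[OF b] sum_distrib_right by (subst sum.swap) simp
  also have "fps_nth \<dots> j = fps_nth ((if a = b then 1 else 0)
      + (\<Sum>x\<in>S. G a x * edge_wt E x b)) j"
    unfolding fps_add_nth fps_sum_nth fps_mult_nth
    by (intro arg_cong2[where f = "(+)"] sum.cong refl) (auto simp: G_nth[OF a le] simp flip: fps_sum_nth)
  finally show "fps_nth (G a b) j = \<dots>" .
qed

text \<open>Convergence is tested coefficientwise. A path with more than \<open>?N\<close> steps
  does not contribute to the coefficient at \<open>j\<close>, so the partial sums are constant there
  once they contain the finite set \<open>?F\<close>.\<close>

lemma has_sum_paths:
  assumes a: "a \<in> S"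
  shows "(path_wt E has_sum G a b) (paths E a b)"
  unfolding has_sum_def
proof (rule tendsto_fpsI)
  fix j
  let ?N = "j * (K + 1) + K"
  let ?F = "\<Union>n\<le>?N. npaths n a b"
  have "fps_nth (sum (path_wt E) F) j = fps_nth (G a b) j"
    if F: "finite F" "?F \<subseteq> F" "F \<subseteq> paths E a b" for F
  proof -
    have "fps_nth (path_wt E p) j = 0" if p: "p \<in> F - ?F" for p
    proof -
      have "p \<in> paths E a b" and "p \<noteq> []" using p F by (auto simp: paths_def)
      then have "p \<in> npaths (length p - 1) a b" by simp
      moreover from this p have "length p - 1 > ?N" by (auto simp: not_le[symmetric])
      ultimately show ?thesis using path_wt_order[OF _ a] by fastforce
    qed
    then have "fps_nth (sum (path_wt E) F) j = fps_nth (sum (path_wt E) ?F) j"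
      unfolding fps_sum_nth by (intro sum.mono_neutral_right F) auto
    also have "sum (path_wt E) ?F = (\<Sum>n\<le>?N. W n a b)"
      unfolding W_def by (rule sum.UNION_disjoint) (use finite_npaths in auto)
    also have "fps_nth \<dots> j = fps_nth (G a b) j" by (rule G_nth[OF a, symmetric]) simp
    finally show ?thesis .
  qed
  moreover have "finite ?F" using finite_npaths by blast
  ultimately show "\<forall>\<^sub>F F in finite_subsets_at_top (paths E a b).
      fps_nth (sum (path_wt E) F) j = fps_nth (G a b) j"
    unfolding eventually_finite_subsets_at_top by (intro exI[of _ ?F]) auto
qed

text \<open>The sum of \<open>G u v * z v\<close> is expanded in two ways, by the equation for
  \<open>z\<close> and by \<open>G_right\<close>; both expansions share the same double sum, which
  cancels.\<close>

lemma G_unique: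
  assumes e: "e \<in> S" and u: "u \<in> S"
    and z: "\<And>u. u \<in> S \<Longrightarrow> z u = (if u = e then 1 else 0) + (\<Sum>v\<in>S. edge_wt E u v * z v)"
  shows "G u e = z u"
proof -
  have "(\<Sum>v\<in>S. G u v * z v)
      = (\<Sum>v\<in>S. if v = e then G u v else 0) + (\<Sum>v\<in>S. \<Sum>x\<in>S. G u v * edge_wt E v x * z x)"
    unfolding sum.distrib[symmetric]
    by (intro sum.cong refl, subst (1) z) (auto simp: algebra_simps sum_distrib_left)
  also have "\<dots> = G u e + (\<Sum>x\<in>S. (\<Sum>v\<in>S. G u v * edge_wt E v x) * z x)"
    using finite_S e by (subst sum.swap) (simp add: sum_distrib_right)
  finally have 1: "(\<Sum>v\<in>S. G u v * z v)
      = G u e + (\<Sum>x\<in>S. (\<Sum>v\<in>S. G u v * edge_wt E v x) * z x)" .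
  have "(\<Sum>v\<in>S. G u v * z v)
      = (\<Sum>v\<in>S. if v = u then z v else 0) + (\<Sum>x\<in>S. (\<Sum>v\<in>S. G u v * edge_wt E v x) * z x)"
    unfolding sum.distrib[symmetric]
    by (intro sum.cong refl, subst (1) G_right[OF u]) (auto simp: algebra_simps)
  also have "(\<Sum>v\<in>S. if v = u then z v else 0) = z u" using finite_S u by simp
  finally show ?thesis using 1 by simp
qed

text \<open>Rows of the transfer matrix are targets, so the inverse is the transpose of
  \<open>G\<close>. Hence \<open>G_right\<close> gives the product with \<open>I - T\<close> on the
  left and \<open>G_left\<close> the other one.\<close>

lemma resolvent_G:
  assumes vs: "distinct vs" "set vs = S"
  defines "T \<equiv> transfer_mat vs E"
  shows "invertible_mat (1\<^sub>m (dim_row T) - T)"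
    and "i < length vs \<Longrightarrow> j < length vs \<Longrightarrow> resolvent T $$ (i, j) = G (vs ! j) (vs ! i)"
proof -
  let ?n = "length vs"
  let ?A = "1\<^sub>m ?n - T"
  let ?B = "mat ?n ?n (\<lambda>(i, j). G (vs ! j) (vs ! i))"
  have T: "T \<in> carrier_mat ?n ?n" by (simp add: T_def transfer_mat_def)
  have A: "?A \<in> carrier_mat ?n ?n" and B: "?B \<in> carrier_mat ?n ?n" using T by auto
  have S: "vs ! i \<in> S" if "i < ?n" for i using vs that by auto
  have eq: "vs ! i = vs ! j \<longleftrightarrow> i = j" if "i < ?n" "j < ?n" for i j
    using vs that by (simp add: nth_eq_iff_index_eq)
  have AB: "?A * ?B = 1\<^sub>m ?n"
  proof (rule eq_matI)
    fix i j assume ij: "i < dim_row (1\<^sub>m ?n)" "j < dim_col (1\<^sub>m ?n)"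
    have "(?A * ?B) $$ (i, j)
        = (\<Sum>k<?n. ((if i = k then 1 else 0) - edge_wt E (vs ! k) (vs ! i)) * G (vs ! j) (vs ! k))"
      using ij T by (simp add: scalar_prod_def T_def transfer_mat_def atLeast0LessThan)
    also have "\<dots> = (\<Sum>k<?n. if k = i then G (vs ! j) (vs ! k) else 0)
        - (\<Sum>k<?n. (\<lambda>v. G (vs ! j) v * edge_wt E v (vs ! i)) (vs ! k))"
      unfolding sum_subtractf[symmetric] by (intro sum.cong) (auto simp: algebra_simps)
    also have "\<dots> = (if i = j then 1 else 0)"
      using ij G_right[of "vs ! j" "vs ! i"]
      by (subst sum_nth_distinct[OF vs(1)]) (auto simp: S eq vs(2))
    finally show "(?A * ?B) $$ (i, j) = 1\<^sub>m ?n $$ (i, j)" using ij by simp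
  qed (use T in auto)
  have BA: "?B * ?A = 1\<^sub>m ?n"
  proof (rule eq_matI)
    fix i j assume ij: "i < dim_row (1\<^sub>m ?n)" "j < dim_col (1\<^sub>m ?n)"
    have "(?B * ?A) $$ (i, j)
        = (\<Sum>k<?n. G (vs ! k) (vs ! i) * ((if k = j then 1 else 0) - edge_wt E (vs ! j) (vs ! k)))"
      using ij T by (simp add: scalar_prod_def T_def transfer_mat_def atLeast0LessThan)
    also have "\<dots> = (\<Sum>k<?n. if k = j then G (vs ! k) (vs ! i) else 0)
        - (\<Sum>k<?n. (\<lambda>v. edge_wt E (vs ! j) v * G v (vs ! i)) (vs ! k))"
      unfolding sum_subtractf[symmetric] by (intro sum.cong) (auto simp: algebra_simps)
    also have "\<dots> = (if i = j then 1 else 0)"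
      using ij G_left[of "vs ! j" "vs ! i"]
      by (subst sum_nth_distinct[OF vs(1)]) (auto simp: S eq vs(2))
    finally show "(?B * ?A) $$ (i, j) = 1\<^sub>m ?n $$ (i, j)" using ij by simp
  qed (use T in auto)
  have dim: "dim_row T = ?n" using T by simp
  show "invertible_mat (1\<^sub>m (dim_row T) - T)"
    unfolding invertible_mat_def inverts_mat_def dim
    using T A B AB BA by (intro conjI exI[of _ ?B]) auto
  have "resolvent T = ?B"
    unfolding resolvent_def dim by (rule mat_inv_eqI[OF A B AB BA])
  then show "i < ?n \<Longrightarrow> j < ?n \<Longrightarrow> resolvent T $$ (i, j) = G (vs ! j) (vs ! i)" by simp
qed

end

section \<open>Monotone segments\<close>

text \<open>Reduces segments to conditions on single steps, the form in which ascents and descents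
  are used later.\<close>

lemma seg_iff:
  "seg r m d \<alpha> i \<longleftrightarrow> 1 \<le> \<alpha> \<and> 1 \<le> i \<and> \<alpha> + i \<le> r + 1 \<and> (\<forall>l\<in>{\<alpha><..<\<alpha> + i}. m l = m (l - 1) + d)"
  (is "_ \<longleftrightarrow> ?R")
proof
  assume s: "seg r m d \<alpha> i"
  have "m l = m (l - 1) + d" if l: "l \<in> {\<alpha><..<\<alpha> + i}" for l
  proof -
    from l obtain k where k: "l = \<alpha> + Suc k" using less_imp_Suc_add[of \<alpha> l] by auto
    with l s have "m (\<alpha> + Suc k) = m \<alpha> + d * int (Suc k)" "m (\<alpha> + k) = m \<alpha> + d * int k"
      by (auto simp: seg_def simp del: add_Suc_right)
    then show ?thesis by (simp add: k algebra_simps)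
  qed
  with s show ?R by (simp add: seg_def)
next
  assume R: ?R
  have "m (\<alpha> + j) = m \<alpha> + d * int j" if "j < i" for j
    using that
  proof (induction j)
    case (Suc j)
    then have "m (\<alpha> + Suc j) = m (\<alpha> + Suc j - 1) + d" using R by auto
    with Suc show ?case by (simp add: algebra_simps)
  qed simp
  with R show "seg r m d \<alpha> i" by (simp add: seg_def)
qed

text \<open>Segments have length at most \<open>r\<close>, so among those containing the given one
  there is a longest, and it is maximal.\<close>

lemma max_seg_extend:
  assumes "seg r m d \<alpha> i"
  obtains \<alpha>' i' where "max_seg r m d \<alpha>' i'" "{\<alpha>..<\<alpha> + i} \<subseteq> {\<alpha>'..<\<alpha>' + i'}"
proof -
  let ?P = "\<lambda>i'. \<exists>\<alpha>'. seg r m d \<alpha>' i' \<and> {\<alpha>..<\<alpha> + i} \<subseteq> {\<alpha>'..<\<alpha>' + i'}"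
  have bound: "\<forall>k. ?P k \<longrightarrow> k \<le> r" by (auto simp: seg_iff)
  define I where "I = (GREATEST k. ?P k)"
  have "?P I" unfolding I_def by (rule GreatestI_nat[where P = ?P]) (use assms bound in blast)+
  then obtain \<alpha>' where \<alpha>': "seg r m d \<alpha>' I" "{\<alpha>..<\<alpha> + i} \<subseteq> {\<alpha>'..<\<alpha>' + I}" by blast
  have "\<beta> = \<alpha>' \<and> k = I" if k: "seg r m d \<beta> k \<and> {\<alpha>'..<\<alpha>' + I} \<subseteq> {\<beta>..<\<beta> + k}" for \<beta> k
  proof -
    from k have "?P k" using \<alpha>' by blast
    then have "k \<le> I" unfolding I_def by (rule Greatest_le_nat[where P = ?P]) (use bound in blast)
    with k \<alpha>'(1) show ?thesis by (auto simp: seg_iff atLeastLessThan_subset_iff)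
  qed
  then have "max_seg r m d \<alpha>' I" using \<alpha>'(1) by (simp add: max_seg_def)
  then show ?thesis using \<alpha>'(2) by (rule that)
qed

text \<open>Removes maximal segments from the description of additional edges. Such an edge may
  reach \<open>\<alpha> + i\<close>, one past the last index of its segment, so only the indices
  strictly between its ends are constrained.\<close>

lemma ex_max_seg_iff:
  assumes "a + 2 \<le> b"
  shows "(\<exists>\<alpha> i. max_seg r m d \<alpha> i \<and> 2 \<le> i \<and> \<alpha> \<le> a \<and> b \<le> \<alpha> + i) \<longleftrightarrow>
    1 \<le> a \<and> b \<le> r + 1 \<and> (\<forall>l\<in>{a<..<b}. m l = m (l - 1) + d)"
proof
  assume "\<exists>\<alpha> i. max_seg r m d \<alpha> i \<and> 2 \<le> i \<and> \<alpha> \<le> a \<and> b \<le> \<alpha> + i"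
  then show "1 \<le> a \<and> b \<le> r + 1 \<and> (\<forall>l\<in>{a<..<b}. m l = m (l - 1) + d)"
    by (auto simp: max_seg_def seg_iff)
next
  assume "1 \<le> a \<and> b \<le> r + 1 \<and> (\<forall>l\<in>{a<..<b}. m l = m (l - 1) + d)"
  then have "seg r m d a (b - a)" using assms by (auto simp: seg_iff)
  then obtain \<alpha> i where "max_seg r m d \<alpha> i" and sub: "{a..<a + (b - a)} \<subseteq> {\<alpha>..<\<alpha> + i}"
    by (rule max_seg_extend)
  moreover have "\<alpha> \<le> a" "b \<le> \<alpha> + i" using sub assms by (auto simp: atLeastLessThan_subset_iff)
  ultimately show "\<exists>\<alpha> i. max_seg r m d \<alpha> i \<and> 2 \<le> i \<and> \<alpha> \<le> a \<and> b \<le> \<alpha> + i"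
    using assms by (intro exI[of _ \<alpha>] exI[of _ i]) auto
qed

section \<open>Transfer of harmonic functions\<close>

text \<open>The skeleton of \<open>\<Gamma>\<^sub>m\<close> is numbered uniformly: \<open>{B n, Q n}\<close> is the edge labelled \<open>2n - 1\<close>, and
  the edge labelled \<open>2n\<close> joins \<open>B n\<close> to \<open>Q (n + 1)\<close> if \<open>m\<close> ascends to \<open>n + 1\<close> and to \<open>B (n + 1)\<close>
  otherwise.\<close>

datatype cvert = B nat | Q nat

locale motzkin_steps =
  fixes r :: nat and m :: "nat \<Rightarrow> int" and y :: "nat \<Rightarrow> 'a::field"
  assumes r_pos: "1 \<le> r"
    and step: "1 \<le> \<alpha> \<Longrightarrow> \<alpha> < r \<Longrightarrow> \<bar>m \<alpha> - m (\<alpha> + 1)\<bar> \<le> 1"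
begin

text \<open>The range \<open>2..r\<close>, here and in \<open>desc\<close>, makes \<open>1\<close>
  and \<open>r + 1\<close> neither ascents nor descents, whatever \<open>m\<close> is outside
  \<open>1..r\<close>.\<close>

definition asc :: "nat \<Rightarrow> bool" where
  "asc n \<longleftrightarrow> 2 \<le> n \<and> n \<le> r \<and> m n = m (n - 1) + 1"

definition desc :: "nat \<Rightarrow> bool" where
  "desc n \<longleftrightarrow> 2 \<le> n \<and> n \<le> r \<and> m n = m (n - 1) - 1"

abbreviation wt :: "nat \<Rightarrow> 'a fps" where
  "wt j \<equiv> fps_X * fps_const (y j)"

text \<open>For \<open>n = Suc n'\<close> no index lies strictly between, and the formula gives the
  ordinary edge of weight \<open>t y_{2n'}\<close>; the same convention lets \<open>up\<close>
  include the edges of weight \<open>1\<close>.\<close>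

definition down :: "nat \<Rightarrow> nat \<Rightarrow> 'a fps" where
  "down n n' = (if \<forall>l\<in>{n'<..<n}. desc l
     then fps_X * fps_const ((\<Prod>j\<in>{n'..<n}. y (2 * j)) / (\<Prod>j\<in>{n'<..<n}. y (2 * j - 1))) else 0)"

definition up :: "nat \<Rightarrow> nat \<Rightarrow> 'a fps" where
  "up n n' = (if \<forall>l\<in>{n<..<n'}. asc l then (-1) ^ (n' - n - 1) else 0)"

definition cwt :: "nat \<Rightarrow> nat \<Rightarrow> 'a fps" where
  "cwt n n' = (if n' < n then down n n' else if n' = n then wt (2 * n - 1) else up n n')"

text \<open>The edge weights of \<Gamma>_m in the uniform numbering. \<open>Q n\<close> is nearer to
  the root than \<open>B n\<close> exactly for \<open>n = 1\<close> and at ascents, which decides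
  the direction carrying \<open>t\<close>. Edges down from the pair \<open>n\<close> start at
  \<open>Q n\<close> if \<open>n\<close> is an ascent and at \<open>B n\<close> otherwise.\<close>

fun swt :: "cvert \<Rightarrow> cvert \<Rightarrow> 'a fps" where
  "swt (B n) (B n') = (if n' = Suc n \<and> \<not> asc n' then 1 else if n' < n \<and> \<not> asc n then down n n' else 0)"
| "swt (B n) (Q n') = (if n' = n then (if n = 1 \<or> asc n then wt (2 * n - 1) else 1)
     else if n' = Suc n \<and> asc n' then 1 else 0)"
| "swt (Q n) (B n') = (if n' = n then (if n = 1 \<or> asc n then 1 else wt (2 * n - 1))
     else if n' < n \<and> asc n then down n n' else 0)"
| "swt (Q n) (Q n') = 0"

definition cverts :: "cvert set" where
  "cverts = B ` {1..r + 1} \<union> Q ` {1..r + 1}"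

lemma finite_cverts: "finite cverts"
  by (simp add: cverts_def)

lemma sum_cverts: "(\<Sum>v\<in>cverts. F v) = (\<Sum>n\<in>{1..r + 1}. F (B n)) + (\<Sum>n\<in>{1..r + 1}. F (Q n))"
  unfolding cverts_def
  by (subst sum.union_disjoint) (auto simp: sum.reindex inj_on_def)

lemma desc_not_asc: "desc n \<Longrightarrow> \<not> asc n"
  by (auto simp: asc_def desc_def)

lemma not_asc_1: "\<not> asc (Suc 0)"
  by (simp add: asc_def)

lemma up_Suc: "up n (Suc n) = 1"
  by (auto simp: up_def)

text \<open>Dropping the intermediate ascent \<open>Suc n\<close> shortens the exponent of
  \<open>-1\<close> by one. This sign is what makes \<open>ups_rec\<close> a two-term
  recursion.\<close>

lemma up_rec:
  assumes "Suc n < n'"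
  shows "up n n' = (if asc (Suc n) then - up (Suc n) n' else 0)"
proof -
  have "{n<..<n'} = insert (Suc n) {Suc n<..<n'}" using assms by auto
  moreover obtain d where "n' = Suc (Suc n + d)" using less_imp_Suc_add[OF assms] by auto
  ultimately show ?thesis by (simp add: up_def)
qed

text \<open>Each ascent rescales by the weight of the skeleton edge that is compactified to a loop.\<close>

primrec tau :: "nat \<Rightarrow> 'a fps" where
  "tau 0 = 1"
| "tau (Suc n) = tau n * (if asc (Suc n) then wt (2 * Suc n - 1) else 1)"

lemma tau_const: "n \<le> n' \<Longrightarrow> (\<And>l. n < l \<Longrightarrow> l \<le> n' \<Longrightarrow> \<not> asc l) \<Longrightarrow> tau n' = tau n"
  by (induction n' rule: dec_induct) auto

context
  fixes z' :: "nat \<Rightarrow> 'a fps"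
begin

definition ups :: "nat \<Rightarrow> 'a fps" where
  "ups n = (\<Sum>n'\<in>{n<..r + 1}. up n n' * z' n')"

text \<open>Where \<open>Q n\<close> is a leaf of \<Gamma>_m, its value is forced by its single
  outgoing edge: it is the weight of that edge times the value at \<open>B n\<close>.\<close>

fun lift :: "cvert \<Rightarrow> 'a fps" where
  "lift (B n) = tau n * z' n"
| "lift (Q n) = (if n = 1 then tau 1 * z' 1 else if asc n then tau (n - 1) * ups (n - 1)
     else wt (2 * n - 1) * (tau n * z' n))"

lemma ups_rec:
  assumes "n \<le> r"
  shows "ups n = z' (Suc n) - (if asc (Suc n) then ups (Suc n) else 0)"
proof -
  have "{n<..r + 1} = insert (Suc n) {Suc n<..r + 1}" using assms by auto
  then have "ups n = z' (Suc n) + (\<Sum>n'\<in>{Suc n<..r + 1}. up n n' * z' n')"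
    by (simp add: ups_def up_Suc)
  also have "(\<Sum>n'\<in>{Suc n<..r + 1}. up n n' * z' n') = - (if asc (Suc n) then ups (Suc n) else 0)"
    by (auto simp: ups_def up_rec sum_negf[symmetric] intro!: sum.cong sum.neutral)
  finally show ?thesis by simp
qed

text \<open>At an ascent this is how \<open>lift\<close> is defined. Otherwise \<open>ups n\<close>
  is just \<open>z' (Suc n)\<close> and \<open>tau\<close> does not change.\<close>

lemma lift_arrival:
  assumes "1 \<le> n" "n \<le> r"
  shows "(if asc (Suc n) then lift (Q (Suc n)) else lift (B (Suc n))) = tau n * ups n"
  using assms ups_rec[of n] by auto

text \<open>A downward edge passes over descents only, where \<open>tau\<close> is constant, so all
  its targets are rescaled by the same factor.\<close>

lemma sum_down_lift:
  "(\<Sum>n'\<in>{1..<n}. down n n' * lift (B n')) = tau (n - 1) * (\<Sum>n'\<in>{1..<n}. down n n' * z' n')"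
  unfolding sum_distrib_left
proof (rule sum.cong[OF refl])
  fix n' assume n': "n' \<in> {1..<n}"
  show "down n n' * lift (B n') = tau (n - 1) * (down n n' * z' n')"
  proof (cases "\<forall>l\<in>{n'<..<n}. desc l")
    case True
    then have "tau (n - 1) = tau n'"
      using n' desc_not_asc by (intro tau_const) auto
    then show ?thesis by simp
  qed (auto simp: down_def)
qed

lemma sum_swt_B:
  assumes n: "n \<in> {1..r + 1}"
  shows "(\<Sum>v\<in>cverts. swt (B n) v * lift v)
    = (if n \<le> r then tau n * ups n else 0)
      + (if n = 1 \<or> asc n then wt (2 * n - 1) else 1) * lift (Q n)
      + (if asc n then 0 else tau (n - 1) * (\<Sum>n'\<in>{1..<n}. down n n' * z' n'))"
proof -
  have "(\<Sum>n'\<in>{1..r + 1}. swt (B n) (B n') * lift (B n'))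
      = (\<Sum>n'\<in>{1..r + 1}. (if n' = Suc n then if asc (Suc n) then 0 else lift (B (Suc n)) else 0)
          + (if n' < n then if asc n then 0 else down n n' * lift (B n') else 0))"
    by (intro sum.cong) auto
  also have "\<dots> = (if n \<le> r then if asc (Suc n) then 0 else lift (B (Suc n)) else 0)
      + (\<Sum>n'\<in>{1..<n}. if asc n then 0 else down n n' * lift (B n'))"
    unfolding sum.distrib sum_if_less[OF n] by (simp del: lift.simps)
  finally have 1: "(\<Sum>n'\<in>{1..r + 1}. swt (B n) (B n') * lift (B n')) = \<dots>" .
  have "(\<Sum>n'\<in>{1..r + 1}. swt (B n) (Q n') * lift (Q n'))
      = (\<Sum>n'\<in>{1..r + 1}.
          (if n' = n then (if n = 1 \<or> asc n then wt (2 * n - 1) else 1) * lift (Q n) else 0)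
          + (if n' = Suc n then if asc (Suc n) then lift (Q (Suc n)) else 0 else 0))"
    by (intro sum.cong) (auto simp del: lift.simps)
  also have "\<dots> = (if n = 1 \<or> asc n then wt (2 * n - 1) else 1) * lift (Q n)
      + (if n \<le> r then if asc (Suc n) then lift (Q (Suc n)) else 0 else 0)"
    unfolding sum.distrib using n by (simp del: lift.simps)
  finally have 2: "(\<Sum>n'\<in>{1..r + 1}. swt (B n) (Q n') * lift (Q n')) = \<dots>" .
  show ?thesis
    unfolding sum_cverts 1 2 using n lift_arrival[of n] sum_down_lift[of n]
    by (auto simp del: lift.simps)
qed

lemma sum_swt_Q:
  assumes n: "n \<in> {1..r + 1}"
  shows "(\<Sum>v\<in>cverts. swt (Q n) v * lift v)
    = (if n = 1 \<or> asc n then 1 else wt (2 * n - 1)) * lift (B n)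
      + (if asc n then tau (n - 1) * (\<Sum>n'\<in>{1..<n}. down n n' * z' n') else 0)"
proof -
  have "(\<Sum>n'\<in>{1..r + 1}. swt (Q n) (B n') * lift (B n'))
      = (\<Sum>n'\<in>{1..r + 1}.
          (if n' = n then (if n = 1 \<or> asc n then 1 else wt (2 * n - 1)) * lift (B n) else 0)
          + (if n' < n then if asc n then down n n' * lift (B n') else 0 else 0))"
    by (intro sum.cong) (auto simp del: lift.simps)
  also have "\<dots> = (if n = 1 \<or> asc n then 1 else wt (2 * n - 1)) * lift (B n)
      + (\<Sum>n'\<in>{1..<n}. if asc n then down n n' * lift (B n') else 0)"
    unfolding sum.distrib sum_if_less[OF n] using n r_pos by (simp del: lift.simps)
  finally show ?thesis
    unfolding sum_cverts using sum_down_lift[of n] by (auto simp del: lift.simps)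
qed

lemma lift_harmonic:
  assumes z': "\<And>n. n \<in> {1..r + 1} \<Longrightarrow>
      z' n = (if n = 1 then 1 else 0) + (\<Sum>n'\<in>{1..r + 1}. cwt n n' * z' n')"
    and u: "u \<in> cverts"
  shows "lift u = (if u = B 1 then 1 else 0) + (\<Sum>v\<in>cverts. swt u v * lift v)"
proof -
  have z'_eq: "z' n = (if n = 1 then 1 else 0) + (\<Sum>n'\<in>{1..<n}. down n n' * z' n')
      + wt (2 * n - 1) * z' n + (if n \<le> r then ups n else 0)" if n: "n \<in> {1..r + 1}" for n
  proof -
    have un: "{1..r + 1} = {1..<n} \<union> {n} \<union> {n<..r + 1}" using n by auto
    have "z' n = (if n = 1 then 1 else 0) + (\<Sum>n'\<in>{1..r + 1}. cwt n n' * z' n')"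
      by (rule z'[OF n])
    also have "(\<Sum>n'\<in>{1..r + 1}. cwt n n' * z' n')
        = (\<Sum>n'\<in>{1..<n}. cwt n n' * z' n') + cwt n n * z' n + (\<Sum>n'\<in>{n<..r + 1}. cwt n n' * z' n')"
      unfolding un by (subst sum.union_disjoint; (subst sum.union_disjoint)?) auto
    also have "(\<Sum>n'\<in>{1..<n}. cwt n n' * z' n') = (\<Sum>n'\<in>{1..<n}. down n n' * z' n')"
      by (intro sum.cong) (auto simp: cwt_def)
    also have "cwt n n = wt (2 * n - 1)" by (simp add: cwt_def)
    also have "(\<Sum>n'\<in>{n<..r + 1}. cwt n n' * z' n') = (if n \<le> r then ups n else 0)"
      using n by (auto simp: cwt_def ups_def intro!: sum.cong)
    finally show ?thesis by (simp only: add.assoc)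
  qed
  from u consider n where "u = B n" "n \<in> {1..r + 1}" | n where "u = Q n" "n \<in> {1..r + 1}"
    by (auto simp: cverts_def)
  then show ?thesis
  proof cases
    case (1 n)
    show ?thesis
    proof (cases "asc n")
      case True
      then obtain k where k: "n = Suc k" "1 \<le> k" "k \<le> r" by (cases n) (auto simp: asc_def)
      \<comment> \<open>Multiplied by \<open>tau n\<close> this is the equation at
        \<open>B n\<close>: \<open>tau n\<close> is \<open>tau k\<close> times the weight of the
        edge from \<open>B n\<close> to \<open>Q n\<close>.\<close>
      have "z' n = ups k + ups n" using ups_rec[OF k(3)] True k by simp
      with True k show ?thesis
        unfolding 1(1) sum_swt_B[OF 1(2)] by (auto simp: asc_def ring_distribs mult_ac)
    next
      case False
      from 1(2) obtain k where k: "n = Suc k" by (cases n) auto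
      with False have tau: "tau n = tau (n - 1)" by simp
      show ?thesis
      proof (cases "n = 1")
        case True
        \<comment> \<open>The loop at \<open>1\<close> becomes the excursion from \<open>B 1\<close>
          to the root \<open>Q 1\<close> and back.\<close>
        then show ?thesis
          unfolding 1(1) sum_swt_B[OF 1(2)] using z'_eq[OF 1(2)] r_pos False
          by (simp add: not_asc_1 add.assoc add.commute[of "wt (Suc 0) * z' (Suc 0)"])
      next
        case n1: False
        \<comment> \<open>Here the loop at \<open>n\<close> becomes the excursion from
          \<open>B n\<close> to the pendant vertex \<open>Q n\<close> and back.\<close>
        have "lift (B n) = tau (n - 1) * z' n" using tau by simp
        also have "\<dots> = tau (n - 1) * ((\<Sum>n'\<in>{1..<n}. down n n' * z' n')
            + wt (2 * n - 1) * z' n + (if n \<le> r then ups n else 0))"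
          by (subst z'_eq[OF 1(2)]) (use n1 in simp)
        also have "\<dots> = (if B n = B 1 then 1 else 0) + (\<Sum>v\<in>cverts. swt (B n) v * lift v)"
          unfolding sum_swt_B[OF 1(2)] using False n1 tau by (auto simp: algebra_simps)
        finally show ?thesis unfolding 1(1) .
      qed
    qed
  next
    case (2 n)
    show ?thesis
    proof (cases "asc n")
      case True
      then obtain k where k: "n = Suc k" "1 \<le> k" "k \<le> r" "n \<le> r" by (cases n) (auto simp: asc_def)
      \<comment> \<open>Removing the upward part from the equation at \<open>n\<close> leaves the
        downward edges and the loop; since \<open>tau k * wt (2 * n - 1)\<close> is
        \<open>tau n\<close>, the loop turns into the edge from \<open>Q n\<close> to
        \<open>B n\<close>.\<close>
      have "ups k = z' n - ups n" using ups_rec[OF k(3)] True k by simp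
      also have "\<dots> = (\<Sum>n'\<in>{1..<n}. down n n' * z' n') + wt (2 * n - 1) * z' n"
        using k z'_eq[OF 2(2)] by (subst diff_eq_eq) auto
      finally have "ups k = \<dots>" .
      then show ?thesis
        unfolding 2(1) sum_swt_Q[OF 2(2)] using True k by (simp add: algebra_simps)
    next
      case False
      then show ?thesis unfolding 2(1) sum_swt_Q[OF 2(2)] by auto
    qed
  qed
qed

end

section \<open>Descending strings\<close>

lemma all_desc_iff:
  "1 \<le> a \<Longrightarrow> b \<le> r + 1 \<Longrightarrow> (\<forall>l\<in>{a<..<b}. m l = m (l - 1) + - 1) \<longleftrightarrow> (\<forall>l\<in>{a<..<b}. desc l)"
  by (intro ball_cong refl) (auto simp: desc_def)

lemma all_asc_iff:
  "1 \<le> a \<Longrightarrow> b \<le> r + 1 \<Longrightarrow> (\<forall>l\<in>{a<..<b}. m l = m (l - 1) + 1) \<longleftrightarrow> (\<forall>l\<in>{a<..<b}. asc l)"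
  by (intro ball_cong refl) (auto simp: asc_def)

text \<open>A segment beginning at a descent can be prolonged to the left. Conversely, if
  \<open>\<alpha>\<close> is no descent, the maximal segment through it cannot have begun
  earlier.\<close>

lemma starts_set: "{\<alpha>. \<exists>i. max_seg r m (-1) \<alpha> i} = {\<alpha>\<in>{1..r}. \<not> desc \<alpha>}"
proof (intro Set.set_eqI iffI)
  fix \<alpha> assume "\<alpha> \<in> {\<alpha>. \<exists>i. max_seg r m (-1) \<alpha> i}"
  then obtain i where i: "max_seg r m (-1) \<alpha> i" by auto
  then have s: "seg r m (-1) \<alpha> i" by (simp add: max_seg_def)
  have "\<not> desc \<alpha>"
  proof
    assume d: "desc \<alpha>"
    have "m l = m (l - 1) + - 1" if "l \<in> {\<alpha> - 1<..<\<alpha> - 1 + (i + 1)}" for l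
      using that s d by (cases "l = \<alpha>") (auto simp: seg_iff desc_def)
    then have "seg r m (-1) (\<alpha> - 1) (i + 1)"
      using s d by (auto simp: seg_iff desc_def)
    moreover have "{\<alpha>..<\<alpha> + i} \<subseteq> {\<alpha> - 1..<\<alpha> - 1 + (i + 1)}" by auto
    ultimately have "i + 1 = i" using i unfolding max_seg_def by blast
    then show False by simp
  qed
  then show "\<alpha> \<in> {\<alpha>\<in>{1..r}. \<not> desc \<alpha>}" using s by (auto simp: seg_iff)
next
  fix \<alpha> assume a: "\<alpha> \<in> {\<alpha>\<in>{1..r}. \<not> desc \<alpha>}"
  then have "seg r m (-1) \<alpha> 1" by (auto simp: seg_iff)
  then obtain \<beta> k where k: "max_seg r m (-1) \<beta> k" and sub: "{\<alpha>..<\<alpha> + 1} \<subseteq> {\<beta>..<\<beta> + k}"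
    by (rule max_seg_extend)
  have "\<beta> = \<alpha>"
  proof (rule ccontr)
    assume "\<beta> \<noteq> \<alpha>"
    with sub have "\<alpha> \<in> {\<beta><..<\<beta> + k}" by auto
    with k a show False by (auto simp: max_seg_def seg_iff desc_def)
  qed
  with k show "\<alpha> \<in> {\<alpha>. \<exists>i. max_seg r m (-1) \<alpha> i}" by auto
qed

text \<open>The sentinel \<open>r + 1\<close> lets one sorted list describe the beginnings and the
  ends of all strings.\<close>

definition breaks :: "nat list" where
  "breaks = starts r m @ [r + 1]"

lemma set_starts: "set (starts r m) = {\<alpha>\<in>{1..r}. \<not> desc \<alpha>}"
  unfolding starts_def starts_set by simp

lemma length_breaks: "length breaks = Suc (nstr r m)"
  by (simp add: breaks_def nstr_def)

lemma sorted_breaks: "sorted_wrt (<) breaks"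
proof -
  have "sorted_wrt (<) (starts r m)" by (simp add: starts_def)
  then show ?thesis using set_starts by (auto simp: breaks_def sorted_wrt_append)
qed

lemma sstart_breaks: "sstart r m i = breaks ! (i - 1)"
  by (simp add: sstart_def breaks_def)

lemma sstart_less: "1 \<le> i \<Longrightarrow> i < j \<Longrightarrow> j \<le> Suc (nstr r m) \<Longrightarrow> sstart r m i < sstart r m j"
  unfolding sstart_breaks by (rule sorted_wrt_nth_less[OF sorted_breaks]) (auto simp: length_breaks)

lemma sstart_mono: "1 \<le> i \<Longrightarrow> i \<le> j \<Longrightarrow> j \<le> Suc (nstr r m) \<Longrightarrow> sstart r m i \<le> sstart r m j"
  using sstart_less[of i j] by (cases "i = j") auto

lemma sstart_last: "sstart r m (Suc (nstr r m)) = Suc r"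
  by (simp add: sstart_breaks breaks_def nstr_def)

lemma sstart_in: "1 \<le> i \<Longrightarrow> i \<le> nstr r m \<Longrightarrow> sstart r m i \<in> {\<alpha>\<in>{1..r}. \<not> desc \<alpha>}"
  unfolding set_starts[symmetric] by (auto simp: sstart_def nstr_def nth_append)

lemma sstart_bounds: "1 \<le> i \<Longrightarrow> i \<le> Suc (nstr r m) \<Longrightarrow> 1 \<le> sstart r m i \<and> sstart r m i \<le> Suc r"
  using sstart_in[of i] sstart_last by (cases "i = Suc (nstr r m)") auto

lemma break_index:
  assumes "n \<in> {1..r}" "\<not> desc n"
  obtains j where "1 \<le> j" "j \<le> nstr r m" "sstart r m j = n"
proof -
  have "n \<in> set (starts r m)" using assms set_starts by auto
  then obtain k where k: "k < length (starts r m)" "starts r m ! k = n" by (auto simp: in_set_conv_nth)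
  then show ?thesis by (intro that[of "Suc k"]) (auto simp: nstr_def sstart_def nth_append)
qed

lemma sstart_1: "sstart r m (Suc 0) = 1" and nstr_pos: "1 \<le> nstr r m"
proof -
  have "1 \<in> {1..r}" "\<not> desc 1" using r_pos by (auto simp: desc_def)
  then obtain j where j: "1 \<le> j" "j \<le> nstr r m" "sstart r m j = 1"
    by (rule break_index)
  then show "1 \<le> nstr r m" by simp
  show "sstart r m (Suc 0) = 1"
    using sstart_mono[of "Suc 0" j] sstart_in[of "Suc 0"] j by auto
qed

lemma sstart_between:
  assumes i: "1 \<le> i" "i \<le> nstr r m" and n: "sstart r m i < n" "n < sstart r m (Suc i)"
  shows "desc n"
proof (rule ccontr)
  assume "\<not> desc n"
  moreover have "n \<in> {1..r}" using n sstart_bounds[of i] sstart_bounds[of "Suc i"] i by auto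
  ultimately obtain j where j: "1 \<le> j" "j \<le> nstr r m" "sstart r m j = n"
    using break_index by blast
  show False
    using sstart_mono[of j i] sstart_mono[of "Suc i" j] i j n by (cases "j \<le> i") auto
qed

lemma string_of:
  assumes "n \<in> {1..r}"
  obtains i where "1 \<le> i" "i \<le> nstr r m" "sstart r m i \<le> n" "n < sstart r m (Suc i)"
proof -
  let ?P = "\<lambda>i. 1 \<le> i \<and> i \<le> nstr r m \<and> sstart r m i \<le> n"
  define i where "i = (GREATEST i. ?P i)"
  have "?P 1" using sstart_1 nstr_pos assms by simp
  then have i: "?P i" unfolding i_def by (rule GreatestI_nat[where P = ?P]) auto
  have "n < sstart r m (Suc i)"
  proof (rule ccontr)
    assume n: "\<not> n < sstart r m (Suc i)"
    with i sstart_last assms have "?P (Suc i)" by (cases "i = nstr r m") auto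
    then have "Suc i \<le> i" unfolding i_def by (rule Greatest_le_nat[where P = ?P]) auto
    then show False by simp
  qed
  with i show ?thesis by (intro that[of i]) auto
qed

lemma sstart_Suc:
  "1 \<le> i \<Longrightarrow> i \<le> nstr r m \<Longrightarrow> sstart r m (Suc i) = sstart r m i + slen r m i \<and> 1 \<le> slen r m i"
  using sstart_less[of i "Suc i"] by (simp add: slen_def)

text \<open>A string start is no descent, so the bound on steps leaves only a flat or an ascending
  separation.\<close>

lemma flat_iff:
  assumes "1 \<le> i" "i < nstr r m"
  shows "flat r m i \<longleftrightarrow> \<not> asc (sstart r m (Suc i))"
proof -
  let ?n = "sstart r m (Suc i)"
  have n: "?n \<le> r" "\<not> desc ?n" using sstart_in[of "Suc i"] assms by auto
  have "sstart r m i < ?n" "1 \<le> sstart r m i"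
    using sstart_less[of i "Suc i"] sstart_in[of i] assms by auto
  then have n2: "2 \<le> ?n" by linarith
  with n step[of "?n - 1"] have "\<bar>m (?n - 1) - m ?n\<bar> \<le> 1" by simp
  with n n2 show ?thesis by (auto simp: flat_def asc_def desc_def)
qed

section \<open>The weights of the compactified graph\<close>

abbreviation desc_wt :: "nat \<Rightarrow> nat \<Rightarrow> 'a fps" where
  "desc_wt n n' \<equiv>
    fps_X * fps_const ((\<Prod>j\<in>{n'..<n}. y (2 * j)) / (\<Prod>j\<in>{n'<..<n}. y (2 * j - 1)))"

text \<open>The gap of at least two separates the additional edges from the ordinary ones.\<close>

definition desc_run :: "nat \<Rightarrow> nat \<Rightarrow> bool" where
  "desc_run n n' \<longleftrightarrow> 1 \<le> n' \<and> n' + 2 \<le> n \<and> n \<le> r + 1 \<and> (\<forall>l\<in>{n'<..<n}. desc l)"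

lemma down_Suc: "down (Suc n) n = wt (2 * n)"
proof -
  have "{n..<Suc n} = {n}" "{n<..<Suc n} = {}" by auto
  then show ?thesis by (simp add: down_def)
qed

text \<open>Describes edges by their ends; the segments and offsets in the definition are absorbed
  by \<open>ex_max_seg_iff\<close>.\<close>

lemma Gamma'_edges_iff:
  "(n, w, n') \<in> Gamma'_edges r m y \<longleftrightarrow> n \<in> {1..r + 1} \<and> n' \<in> {1..r + 1} \<and>
     (n' = Suc n \<and> w = 1 \<or> n = Suc n' \<and> w = wt (2 * n') \<or> n' = n \<and> w = wt (2 * n - 1) \<or>
      desc_run n n' \<and> w = desc_wt n n' \<or>
      n + 2 \<le> n' \<and> (\<forall>l\<in>{n<..<n'}. asc l) \<and> w = (-1) ^ (n' - n - 1))"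
  (is "_ \<longleftrightarrow> ?R")
proof -
  have desc: "(\<exists>\<alpha> i p q. n = \<alpha> + p \<and> w = fps_X * fps_const
           ((\<Prod>j\<in>{\<alpha> + q..\<alpha> + p - 1}. y (2 * j)) / (\<Prod>j\<in>{\<alpha> + q + 1..\<alpha> + p - 1}. y (2 * j - 1))) \<and>
         n' = \<alpha> + q \<and> max_seg r m (-1) \<alpha> i \<and> 2 \<le> i \<and> q + 2 \<le> p \<and> p \<le> i)
      \<longleftrightarrow> desc_run n n' \<and> w = desc_wt n n'" (is "?L1 \<longleftrightarrow> ?R1")
  proof -
    have "?L1 \<longleftrightarrow> n' + 2 \<le> n \<and> (\<exists>\<alpha> i. max_seg r m (-1) \<alpha> i \<and> 2 \<le> i \<and> \<alpha> \<le> n' \<and> n \<le> \<alpha> + i)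
        \<and> w = desc_wt n n'" (is "_ \<longleftrightarrow> ?M")
    proof
      assume ?L1
      then obtain \<alpha> i p q where *: "n = \<alpha> + p" "n' = \<alpha> + q" "max_seg r m (-1) \<alpha> i" "2 \<le> i"
        "q + 2 \<le> p" "p \<le> i" "w = fps_X * fps_const
           ((\<Prod>j\<in>{\<alpha> + q..\<alpha> + p - 1}. y (2 * j)) / (\<Prod>j\<in>{\<alpha> + q + 1..\<alpha> + p - 1}. y (2 * j - 1)))"
        by blast
      have "{\<alpha> + q..\<alpha> + p - 1} = {n'..<n}" "{\<alpha> + q + 1..\<alpha> + p - 1} = {n'<..<n}"
        using *(1,2,5) by auto
      with *(7) have "w = desc_wt n n'" by simp
      moreover have "n' + 2 \<le> n" "\<alpha> \<le> n'" "n \<le> \<alpha> + i" using *(1,2,5,6) by auto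
      ultimately show ?M using *(3,4) by blast
    next
      assume M: ?M
      then obtain \<alpha> i where *: "max_seg r m (-1) \<alpha> i" "2 \<le> i" "\<alpha> \<le> n'" "n \<le> \<alpha> + i" by blast
      have "{\<alpha> + (n' - \<alpha>)..\<alpha> + (n - \<alpha>) - 1} = {n'..<n}"
        "{\<alpha> + (n' - \<alpha>) + 1..\<alpha> + (n - \<alpha>) - 1} = {n'<..<n}"
        using *(3) M by auto
      then have w: "w = fps_X * fps_const
           ((\<Prod>j\<in>{\<alpha> + (n' - \<alpha>)..\<alpha> + (n - \<alpha>) - 1}. y (2 * j))
            / (\<Prod>j\<in>{\<alpha> + (n' - \<alpha>) + 1..\<alpha> + (n - \<alpha>) - 1}. y (2 * j - 1)))"
        using M by (simp only:)
      have "n = \<alpha> + (n - \<alpha>)" "n' = \<alpha> + (n' - \<alpha>)" "n' - \<alpha> + 2 \<le> n - \<alpha>" "n - \<alpha> \<le> i"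
        using *(3,4) M by auto
      with w *(1,2) show ?L1
        by - (rule exI[of _ \<alpha>], rule exI[of _ i], rule exI[of _ "n - \<alpha>"],
            rule exI[of _ "n' - \<alpha>"], intro conjI)
    qed
    also have "\<dots> \<longleftrightarrow> ?R1"
      using ex_max_seg_iff[of n' n r m "-1"] all_desc_iff[of n' n] by (auto simp: desc_run_def)
    finally show ?thesis .
  qed
  have asc: "(\<exists>\<alpha> i p q. n = \<alpha> + q \<and> w = (-1) ^ (p - q - 1) \<and> n' = \<alpha> + p \<and>
         max_seg r m 1 \<alpha> i \<and> 2 \<le> i \<and> q + 2 \<le> p \<and> p \<le> i)
      \<longleftrightarrow> 1 \<le> n \<and> n' \<le> r + 1 \<and> n + 2 \<le> n' \<and> (\<forall>l\<in>{n<..<n'}. asc l) \<and> w = (-1) ^ (n' - n - 1)"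
    (is "?L2 \<longleftrightarrow> ?R2")
  proof -
    have "?L2 \<longleftrightarrow> n + 2 \<le> n' \<and> (\<exists>\<alpha> i. max_seg r m 1 \<alpha> i \<and> 2 \<le> i \<and> \<alpha> \<le> n \<and> n' \<le> \<alpha> + i)
        \<and> w = (-1) ^ (n' - n - 1)" (is "_ \<longleftrightarrow> ?M")
    proof
      assume ?L2
      then obtain \<alpha> i p q where *: "n = \<alpha> + q" "n' = \<alpha> + p" "max_seg r m 1 \<alpha> i" "2 \<le> i"
        "q + 2 \<le> p" "p \<le> i" "w = (-1) ^ (p - q - 1)"
        by blast
      then have "n + 2 \<le> n'" "\<alpha> \<le> n" "n' \<le> \<alpha> + i" "w = (-1) ^ (n' - n - 1)" by simp_all
      with *(3,4) show ?M by blast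
    next
      assume M: ?M
      then obtain \<alpha> i where *: "max_seg r m 1 \<alpha> i" "2 \<le> i" "\<alpha> \<le> n" "n' \<le> \<alpha> + i" by blast
      have "n = \<alpha> + (n - \<alpha>)" "n' = \<alpha> + (n' - \<alpha>)" "n - \<alpha> + 2 \<le> n' - \<alpha>" "n' - \<alpha> \<le> i"
        "w = (-1) ^ (n' - \<alpha> - (n - \<alpha>) - 1)"
        using *(3,4) M by auto
      with *(1,2) show ?L2
        by - (rule exI[of _ \<alpha>], rule exI[of _ i], rule exI[of _ "n' - \<alpha>"],
            rule exI[of _ "n - \<alpha>"], intro conjI)
    qed
    also have "\<dots> \<longleftrightarrow> ?R2"
      using ex_max_seg_iff[of n n' r m 1] all_asc_iff[of n n'] by auto
    finally show ?thesis .
  qed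
  have D: "(n, w, n') \<in> {(\<alpha> + p, fps_X * fps_const
           ((\<Prod>j\<in>{\<alpha> + q..\<alpha> + p - 1}. y (2 * j)) / (\<Prod>j\<in>{\<alpha> + q + 1..\<alpha> + p - 1}. y (2 * j - 1))),
         \<alpha> + q) | \<alpha> i p q. max_seg r m (-1) \<alpha> i \<and> 2 \<le> i \<and> q + 2 \<le> p \<and> p \<le> i} \<longleftrightarrow> ?R1"
    unfolding desc[symmetric] by (simp only: mem_Collect_eq prod.inject conj_assoc)
  have A: "(n, w, n') \<in> {(\<alpha> + q, (-1) ^ (p - q - 1), \<alpha> + p) | \<alpha> i p q.
         max_seg r m 1 \<alpha> i \<and> 2 \<le> i \<and> q + 2 \<le> p \<and> p \<le> i} \<longleftrightarrow> ?R2"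
    unfolding asc[symmetric] by (simp only: mem_Collect_eq prod.inject conj_assoc)
  \<comment> \<open>Each of the five families is brought into this form, so that they combine by
    propositional reasoning.\<close>
  let ?I = "\<lambda>P. n \<in> {1..r + 1} \<and> n' \<in> {1..r + 1} \<and> P"
  have "(n, w, n') \<in> {(i, 1, i + 1) | i. 1 \<le> i \<and> i \<le> r} \<longleftrightarrow> ?I (n' = Suc n \<and> w = 1)"
    by auto
  moreover have "(n, w, n') \<in> {(i + 1, wt (2 * i), i) | i. 1 \<le> i \<and> i \<le> r}
      \<longleftrightarrow> ?I (n = Suc n' \<and> w = wt (2 * n'))"
    by auto
  moreover have "(n, w, n') \<in> {(i, wt (2 * i - 1), i) | i. 1 \<le> i \<and> i \<le> r + 1}
      \<longleftrightarrow> ?I (n' = n \<and> w = wt (2 * n - 1))"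
    by auto
  moreover have "?R1 \<longleftrightarrow> ?I ?R1" by (auto simp: desc_run_def)
  moreover have "?R2 \<longleftrightarrow> ?I (n + 2 \<le> n' \<and> (\<forall>l\<in>{n<..<n'}. asc l) \<and> w = (-1) ^ (n' - n - 1))"
    by auto
  ultimately show ?thesis
    unfolding Gamma'_edges_def Un_iff D A by argo
qed

lemma edge_wt_Gamma':
  assumes n: "n \<in> {1..r + 1}" and n': "n' \<in> {1..r + 1}"
  shows "edge_wt (Gamma'_edges r m y) n n' = cwt n n'"
proof (rule edge_wt_eqI)
  fix w assume "(n, w, n') \<in> Gamma'_edges r m y"
  then consider "n' = Suc n" "w = 1" | "n = Suc n'" "w = wt (2 * n')" | "n' = n" "w = wt (2 * n - 1)"
    | "desc_run n n'" "w = desc_wt n n'"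
    | "n + 2 \<le> n'" "\<forall>l\<in>{n<..<n'}. asc l" "w = (-1) ^ (n' - n - 1)"
    unfolding Gamma'_edges_iff by blast
  then show "w = cwt n n'"
  proof cases
    case 4
    then have "n' < n" "down n n' = desc_wt n n'" by (simp_all add: down_def desc_run_def)
    then show ?thesis by (simp only: cwt_def if_True 4(2))
  next
    case 5
    have "up n n' = w" by (simp only: up_def if_P[OF 5(2)] 5(3))
    with 5(1) show ?thesis by (simp add: cwt_def)
  qed (simp_all add: cwt_def down_Suc up_Suc)
next
  assume nz: "cwt n n' \<noteq> 0"
  consider "n = Suc n'" | "n' + 2 \<le> n" | "n = n'" | "n' = Suc n" | "n + 2 \<le> n'" by linarith
  then show "(n, cwt n n', n') \<in> Gamma'_edges r m y"
  proof cases
    case 2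
    then have "cwt n n' = down n n'" by (simp add: cwt_def)
    with nz 2 n n' have "desc_run n n'" "cwt n n' = desc_wt n n'"
      by (auto simp: down_def desc_run_def split: if_splits)
    with n n' show ?thesis unfolding Gamma'_edges_iff by blast
  next
    case 5
    then have "cwt n n' = up n n'" by (simp add: cwt_def)
    with nz have "\<forall>l\<in>{n<..<n'}. asc l" "cwt n n' = (-1) ^ (n' - n - 1)"
      by (auto simp: up_def split: if_splits)
    with n n' 5 show ?thesis unfolding Gamma'_edges_iff by blast
  qed (use n n' in \<open>simp_all add: Gamma'_edges_iff cwt_def down_Suc up_Suc\<close>)
qed

section \<open>Uniform numbering of the glued graph\<close>

text \<open>The vertex of the pair \<open>n\<close> at which the edge from \<open>B (n - 1)\<close>
  ends; \<open>opposite n\<close> is the other one.\<close>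

definition arrival :: "nat \<Rightarrow> cvert" where
  "arrival n = (if asc n then Q n else B n)"

definition opposite :: "nat \<Rightarrow> cvert" where
  "opposite n = (if asc n then B n else Q n)"

text \<open>Defined on every copy of a vertex, before gluing. The last two vertices of a piece
  belong to the pair at which the next string starts; for the last piece this is the pair
  \<open>r + 1\<close>, where vertex \<open>k + 1\<close> becomes \<open>B (r + 1)\<close>.\<close>

fun nu :: "nat \<times> gvert \<Rightarrow> cvert" where
  "nu (i, V a) = (let s = sstart r m i; k = slen r m i in
     if a = 0 then Q s else if a \<le> k then B (s + a - 1)
     else if a = k + 1 then arrival (s + k) else opposite (s + k))"
| "nu (i, P a) = Q (sstart r m i + a - 1)"

lemma nu_simps:
  assumes "1 \<le> i" "i \<le> nstr r m"
  shows "nu (i, V 0) = Q (sstart r m i)" "nu (i, V (Suc 0)) = B (sstart r m i)"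
    "nu (i, V (Suc (slen r m i))) = arrival (sstart r m (Suc i))"
    "nu (i, V (Suc (Suc (slen r m i)))) = opposite (sstart r m (Suc i))"
  using sstart_Suc[OF assms] by (auto simp: Let_def)

lemma nu_V:
  "1 \<le> a \<Longrightarrow> a \<le> slen r m i \<Longrightarrow> nu (i, V a) = B (sstart r m i + a - 1)"
  by (simp add: Let_def)

text \<open>The flat and the ascending gluing differ by exchanging the last two vertices of the
  preceding piece, just as \<open>arrival\<close> and \<open>opposite\<close> exchange
  \<open>B\<close> and \<open>Q\<close>. Hence identified copies have the same image.\<close>

lemma nu_glue:
  assumes i: "1 \<le> i" "i \<le> nstr r m"
  shows "nu (glue r m i v) = nu (i, v)"
proof (cases "2 \<le> i \<and> (v = V 0 \<or> v = V 1)")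
  case True
  then obtain j where j: "i = Suc j" "1 \<le> j" "j < nstr r m" using i by (cases i) auto
  then have j': "j \<le> nstr r m" by simp
  show ?thesis
    using True j(2) flat_iff[OF j(2,3)] nu_simps[OF i] nu_simps[OF j(2) j']
    by (auto simp: glue_def Let_def j(1) arrival_def opposite_def simp del: nu.simps)
next
  case False
  then show ?thesis by (auto simp: glue_def Let_def)
qed

lemma glue_in:
  assumes "1 \<le> i" "i \<le> nstr r m" "v \<in> Gt_verts (slen r m i)"
  shows "glue r m i v \<in> Gamma_verts r m"
  using assms by (auto simp: Gamma_verts_def)

text \<open>Vertices \<open>0\<close> and \<open>1\<close> of all pieces but the first have been replaced by their representatives.\<close>

lemma Gamma_verts_rep:
  assumes "x \<in> Gamma_verts r m"
  obtains i v where "x = (i, v)" "1 \<le> i" "i \<le> nstr r m" "v \<in> Gt_verts (slen r m i)"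
    "2 \<le> i \<longrightarrow> v \<noteq> V 0 \<and> v \<noteq> V 1"
proof -
  obtain i v where iv: "x = glue r m i v" "1 \<le> i" "i \<le> nstr r m" "v \<in> Gt_verts (slen r m i)"
    using assms by (auto simp: Gamma_verts_def)
  show ?thesis
  proof (cases "2 \<le> i \<and> (v = V 0 \<or> v = V 1)")
    case True
    let ?k = "slen r m (i - 1)"
    have "1 \<le> ?k" using sstart_Suc[of "i - 1"] True iv by auto
    then obtain u where u: "x = (i - 1, V u)" "u = ?k + 1 \<or> u = ?k + 2"
      using True iv(1) by (auto simp: glue_def Let_def)
    with True iv \<open>1 \<le> ?k\<close> show ?thesis
      by (intro that[of "i - 1" "V u"]) (auto simp: Gt_verts_def)
  next
    case False
    then have "x = (i, v)" using iv(1) by (auto simp: glue_def Let_def)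
    then show ?thesis using iv False by (intro that[of i v]) auto
  qed
qed

fun num :: "cvert \<Rightarrow> nat" where "num (B n) = n" | "num (Q n) = n"

lemma num_arrival [simp]: "num (arrival n) = n" "num (opposite n) = n"
  by (auto simp: arrival_def opposite_def)

text \<open>Apart from vertices \<open>0\<close> and \<open>1\<close>, distinct pieces occupy
  disjoint ranges of numbers; this separates the pieces in \<open>nu_inj\<close>.\<close>

lemma num_nu:
  assumes i: "1 \<le> i" "i \<le> nstr r m" and v: "v \<in> Gt_verts (slen r m i)" "v \<noteq> V 0" "v \<noteq> V 1"
  shows "sstart r m i < num (nu (i, v)) \<and> num (nu (i, v)) \<le> sstart r m (Suc i)"
  using v sstart_Suc[OF i] by (auto simp: Gt_verts_def Let_def)

lemma nu_0_1: "nu (Suc 0, V 0) = Q 1" "nu (Suc 0, V (Suc 0)) = B 1"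
  using nu_simps[of 1] nstr_pos sstart_1 by auto

lemma nu_inj_piece:
  assumes i: "1 \<le> i" "i \<le> nstr r m" and v: "v \<in> Gt_verts (slen r m i)" "v' \<in> Gt_verts (slen r m i)"
    and eq: "nu (i, v) = nu (i, v')"
  shows "v = v'"
proof -
  have "arrival n \<noteq> opposite n" for n by (simp add: arrival_def opposite_def)
  with sstart_Suc[OF i] v eq show ?thesis
    by (auto simp: Gt_verts_def Let_def arrival_def opposite_def split: if_splits)
qed

lemma nu_inj: "inj_on nu (Gamma_verts r m)"
proof (rule inj_onI)
  fix x x' assume x: "x \<in> Gamma_verts r m" and x': "x' \<in> Gamma_verts r m" and eq: "nu x = nu x'"
  obtain i v where iv: "x = (i, v)" "1 \<le> i" "i \<le> nstr r m" "v \<in> Gt_verts (slen r m i)"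
    "2 \<le> i \<longrightarrow> v \<noteq> V 0 \<and> v \<noteq> V 1" using x by (rule Gamma_verts_rep)
  obtain i' v' where iv': "x' = (i', v')" "1 \<le> i'" "i' \<le> nstr r m" "v' \<in> Gt_verts (slen r m i')"
    "2 \<le> i' \<longrightarrow> v' \<noteq> V 0 \<and> v' \<noteq> V 1" using x' by (rule Gamma_verts_rep)
  have *: False
    if "1 \<le> i" "i < i'" "i' \<le> nstr r m" "v \<in> Gt_verts (slen r m i)" "v' \<in> Gt_verts (slen r m i')"
      "2 \<le> i' \<longrightarrow> v' \<noteq> V 0 \<and> v' \<noteq> V 1" "nu (i, v) = nu (i', v')" for i i' v v'
  proof -
    have le: "num (nu (i, v)) \<le> sstart r m (Suc i)"
    proof (cases "v = V 0 \<or> v = V 1")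
      case True
      with that(1-3) nu_simps(1,2)[of i] have "num (nu (i, v)) = sstart r m i"
        by (auto simp del: nu.simps)
      with sstart_less[of i "Suc i"] that show ?thesis by auto
    next
      case False
      with num_nu[of i v] that show ?thesis by auto
    qed
    have "sstart r m i' < num (nu (i', v'))" using num_nu[of i' v'] that by auto
    moreover have "sstart r m (Suc i) \<le> sstart r m i'" using that by (intro sstart_mono) auto
    ultimately show False using le that(7) by simp
  qed
  have "i = i'"
    using *[of i i' v v'] *[of i' i v' v] iv iv' eq by (cases i i' rule: linorder_cases) auto
  with nu_inj_piece[of i v v'] iv iv' eq show "x = x'" by auto
qed

lemma nu_in_cverts:
  assumes i: "1 \<le> i" "i \<le> nstr r m" and v: "v \<in> Gt_verts (slen r m i)"
  shows "nu (i, v) \<in> cverts"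
proof -
  have "1 \<le> num (nu (i, v)) \<and> num (nu (i, v)) \<le> r + 1"
  proof (cases "v = V 0 \<or> v = V 1")
    case True
    with nu_simps(1,2)[OF i] sstart_bounds[of i] i show ?thesis by auto
  next
    case False
    with num_nu[OF i v] sstart_bounds[of i] sstart_bounds[of "Suc i"] i show ?thesis by auto
  qed
  then show ?thesis by (cases "nu (i, v)") (auto simp: cverts_def)
qed

lemma nu_surj:
  assumes n: "n \<in> {1..r + 1}"
  shows "B n \<in> nu ` Gamma_verts r m \<and> Q n \<in> nu ` Gamma_verts r m"
proof (cases "n = 1")
  case True
  have "glue r m 1 (V j) \<in> Gamma_verts r m" if "j \<le> 1" for j
    using nstr_pos that by (intro glue_in) (auto simp: Gt_verts_def)
  then have "nu (glue r m 1 (V 0)) \<in> nu ` Gamma_verts r m"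
    "nu (glue r m 1 (V 1)) \<in> nu ` Gamma_verts r m" by auto
  then show ?thesis using nu_0_1 nstr_pos True by (simp add: nu_glue del: nu.simps)
next
  case False
  with n have "n - 1 \<in> {1..r}" by auto
  then obtain i where i: "1 \<le> i" "i \<le> nstr r m" "sstart r m i \<le> n - 1" "n - 1 < sstart r m (Suc i)"
    by (rule string_of)
  have im: "nu (i, v) \<in> nu ` Gamma_verts r m" if "v \<in> Gt_verts (slen r m i)" for v
    using glue_in[OF i(1,2) that] nu_glue[OF i(1,2)] by (metis imageI)
  \<comment> \<open>The pair \<open>n\<close> lies in the piece whose string contains
    \<open>n - 1\<close>, and \<open>a\<close> solves
    \<open>n = sstart r m i + a - 1\<close>.\<close>
  define a where "a = n - sstart r m i + 1"
  have a: "2 \<le> a" "a \<le> slen r m i + 1" "n = sstart r m i + a - 1"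
    using i sstart_Suc[of i] False n by (auto simp: a_def)
  show ?thesis
  proof (cases "a = slen r m i + 1")
    case True
    then have "n = sstart r m (Suc i)" using a sstart_Suc[OF i(1,2)] by simp
    then show ?thesis
      using im[of "V (Suc (slen r m i))"] im[of "V (Suc (Suc (slen r m i)))"] nu_simps(3,4)[OF i(1,2)]
      by (auto simp: Gt_verts_def arrival_def opposite_def simp del: nu.simps split: if_splits)
  next
    case False
    then show ?thesis
      using im[of "V a"] im[of "P a"] a by (auto simp: Gt_verts_def Let_def)
  qed
qed

lemma nu_bij: "bij_betw nu (Gamma_verts r m) cverts"
  unfolding bij_betw_def
proof (intro conjI nu_inj equalityI subsetI)
  fix c assume "c \<in> nu ` Gamma_verts r m"
  then show "c \<in> cverts"
    using Gamma_verts_rep nu_in_cverts by (metis imageE)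
next
  fix c assume "c \<in> cverts"
  then show "c \<in> nu ` Gamma_verts r m"
    using nu_surj by (auto simp: cverts_def)
qed

subsection \<open>The skeleton\<close>

definition cskel :: "nat \<Rightarrow> cvert \<Rightarrow> cvert \<Rightarrow> bool" where
  "cskel l u v \<longleftrightarrow> (\<exists>n\<in>{1..r + 1}. l = 2 * n - 1 \<and> {u, v} = {Q n, B n}) \<or>
     (\<exists>n\<in>{1..r}. l = 2 * n \<and> {u, v} = {B n, arrival (Suc n)})"

lemma cskel_sym: "cskel l u v = cskel l v u"
  by (simp add: cskel_def insert_commute)

lemma cskel_odd: "n \<in> {1..r + 1} \<Longrightarrow> cskel (2 * n - 1) (Q n) (B n)"
  and cskel_even: "n \<in> {1..r} \<Longrightarrow> cskel (2 * n) (B n) (arrival (Suc n))"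
  by (auto simp: cskel_def)

text \<open>Indices inside a string are descents, where \<open>arrival\<close> is \<open>B\<close>;
  thus the end of the string needs no separate formula.\<close>

lemma nu_V_arrival:
  assumes i: "1 \<le> i" "i \<le> nstr r m" and a: "2 \<le> a" "a \<le> slen r m i + 1"
  shows "nu (i, V a) = arrival (sstart r m i + a - 1)"
proof (cases "a = slen r m i + 1")
  case False
  with a sstart_Suc[OF i] have "desc (sstart r m i + a - 1)"
    by (intro sstart_between[OF i]) auto
  with False a show ?thesis by (simp add: Let_def arrival_def desc_not_asc)
qed (simp add: Let_def)

lemma Gt_edge_cskel:
  assumes i: "1 \<le> i" "i \<le> nstr r m" and e: "(l, u, v) \<in> Gt_edges (slen r m i)"
  shows "cskel (l + 2 * (sstart r m i - 1)) (nu (i, u)) (nu (i, v))"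
    and "u \<in> Gt_verts (slen r m i)" "v \<in> Gt_verts (slen r m i)"
proof -
  let ?s = "sstart r m i" and ?k = "slen r m i"
  have s: "1 \<le> ?s" "?s + ?k \<le> Suc r" "1 \<le> ?k"
    using sstart_bounds[of i] sstart_bounds[of "Suc i"] sstart_Suc[OF i] i by auto
  from e consider "l = 1" "u = V 0" "v = V 1"
    | j where "1 \<le> j" "j \<le> ?k" "l = 2 * j" "u = V j" "v = V (j + 1)"
    | j where "2 \<le> j" "j \<le> ?k" "l = 2 * j - 1" "u = V j" "v = P j"
    | "l = 2 * ?k + 1" "u = V (?k + 1)" "v = V (?k + 2)"
    by (auto simp: Gt_edges_def)
  then show "cskel (l + 2 * (?s - 1)) (nu (i, u)) (nu (i, v))"
  proof cases
    case 1
    have "l + 2 * (?s - 1) = 2 * ?s - 1" using s 1 by simp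
    then show ?thesis using cskel_odd[of ?s] s 1 nu_simps(1,2)[OF i] by simp
  next
    case (2 j)
    have "nu (i, v) = arrival (Suc (?s + j - 1))" using nu_V_arrival[OF i, of "j + 1"] 2 s by simp
    moreover have "l + 2 * (?s - 1) = 2 * (?s + j - 1)" using s 2 by simp
    ultimately show ?thesis using cskel_even[of "?s + j - 1"] s 2 nu_V[of j i] by simp
  next
    case (3 j)
    have n: "?s + j - 1 \<in> {1..r + 1}" and "l + 2 * (?s - 1) = 2 * (?s + j - 1) - 1"
      using s 3 by auto
    then show ?thesis using cskel_odd[OF n] 3 nu_V[of j i] by (simp add: cskel_sym)
  next
    case 4
    have "l + 2 * (?s - 1) = 2 * (?s + ?k) - 1" using s 4 by simp
    then show ?thesis using cskel_odd[of "?s + ?k"] s 4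
      by (auto simp: Let_def arrival_def opposite_def cskel_sym)
  qed
  show "u \<in> Gt_verts ?k" "v \<in> Gt_verts ?k" using e s(3) by (auto simp: Gt_edges_def Gt_verts_def)
qed

lemma skel_cskel:
  assumes "(l, x, x') \<in> skel r m"
  shows "cskel l (nu x) (nu x')" and "x \<in> Gamma_verts r m" "x' \<in> Gamma_verts r m"
proof -
  obtain i k u v where *: "l = k + 2 * (sstart r m i - 1)" "x = glue r m i u" "x' = glue r m i v"
    "1 \<le> i" "i \<le> nstr r m" "(k, u, v) \<in> Gt_edges (slen r m i) \<or> (k, v, u) \<in> Gt_edges (slen r m i)"
    using assms by (auto simp: skel_def)
  with Gt_edge_cskel[of i k u v] Gt_edge_cskel[of i k v u]
  show "cskel l (nu x) (nu x')" "x \<in> Gamma_verts r m" "x' \<in> Gamma_verts r m"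
    by (auto simp: nu_glue glue_in cskel_sym simp del: nu.simps)
qed

lemma cskel_piece:
  assumes "cskel l c c'"
  obtains i k u v where "1 \<le> i" "i \<le> nstr r m" "l = k + 2 * (sstart r m i - 1)"
    "(k, u, v) \<in> Gt_edges (slen r m i)" "{nu (i, u), nu (i, v)} = {c, c'}"
proof -
  note piece = that
  \<comment> \<open>The edge labelled \<open>2n\<close> belongs to the string containing
    \<open>n\<close>.\<close>
  have even: thesis if n: "n \<in> {1..r}" "l = 2 * n" "{B n, arrival (Suc n)} = {c, c'}" for n
  proof -
    obtain i where i: "1 \<le> i" "i \<le> nstr r m" "sstart r m i \<le> n" "n < sstart r m (Suc i)"
      using n(1) by (rule string_of)
    let ?j = "n - sstart r m i + 1"
    have s: "1 \<le> sstart r m i" "?j \<le> slen r m i"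
      using sstart_bounds[of i] sstart_Suc[of i] i by auto
    have "nu (i, V ?j) = B n" "nu (i, V (?j + 1)) = arrival (Suc n)"
      using nu_V[of ?j i] nu_V_arrival[OF i(1,2), of "?j + 1"] s i(3) by auto
    moreover have "(2 * ?j, V ?j, V (?j + 1)) \<in> Gt_edges (slen r m i)"
      using s(2) by (auto simp: Gt_edges_def)
    moreover have "l = 2 * ?j + 2 * (sstart r m i - 1)" using s(1) i(3) n(2) by simp
    ultimately show thesis using i(1,2) n(3) by (intro piece[of i "2 * ?j" "V ?j" "V (?j + 1)"]) auto
  qed
  \<comment> \<open>For \<open>n > 1\<close> the edge labelled \<open>2n - 1\<close> belongs to the
    string containing \<open>n - 1\<close>: it is the final edge of the piece if that string ends at
    \<open>n - 1\<close>, and a pendant edge otherwise.\<close>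
  have odd: thesis if n: "n \<in> {1..r + 1}" "l = 2 * n - 1" "{Q n, B n} = {c, c'}" for n
  proof (cases "n = 1")
    case True
    show thesis
      by (rule piece[of 1 1 "V 0" "V 1"]) (use True n nstr_pos sstart_1 nu_0_1 in \<open>auto simp: Gt_edges_def\<close>)
  next
    case False
    with n have "n - 1 \<in> {1..r}" by auto
    then obtain i where i: "1 \<le> i" "i \<le> nstr r m" "sstart r m i \<le> n - 1" "n - 1 < sstart r m (Suc i)"
      by (rule string_of)
    have s: "1 \<le> sstart r m i" "n \<le> sstart r m i + slen r m i"
      using sstart_bounds[of i] sstart_Suc[of i] i by auto
    show thesis
    proof (cases "n = sstart r m i + slen r m i")
      case True
      let ?k = "slen r m i"
      have "nu (i, V (?k + 1)) = arrival n" "nu (i, V (?k + 2)) = opposite n"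
        using True by (auto simp: Let_def)
      moreover have "{arrival n, opposite n} = {Q n, B n}" by (auto simp: arrival_def opposite_def)
      moreover have "(2 * ?k + 1, V (?k + 1), V (?k + 2)) \<in> Gt_edges ?k" by (auto simp: Gt_edges_def)
      moreover have "l = 2 * ?k + 1 + 2 * (sstart r m i - 1)" using True s(1) n(2) by simp
      ultimately show thesis using i(1,2) n(3)
        by (intro piece[of i "2 * ?k + 1" "V (?k + 1)" "V (?k + 2)"]) (auto simp del: nu.simps)
    next
      case neq: False
      let ?j = "n - sstart r m i + 1"
      have j: "2 \<le> ?j" "?j \<le> slen r m i" using neq s i(3) False n(1) by auto
      then have "nu (i, V ?j) = B n" "nu (i, P ?j) = Q n" using nu_V[of ?j i] i(3) by auto
      moreover have "(2 * ?j - 1, V ?j, P ?j) \<in> Gt_edges (slen r m i)"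
        using j by (auto simp: Gt_edges_def)
      moreover have "l = 2 * ?j - 1 + 2 * (sstart r m i - 1)" using s(1) i(3) n(2) by simp
      ultimately show thesis using i(1,2) n(3)
        by (intro piece[of i "2 * ?j - 1" "V ?j" "P ?j"]) (auto simp del: nu.simps)
    qed
  qed
  from assms show thesis unfolding cskel_def using even odd by metis
qed

lemma skel_iff:
  assumes x: "x \<in> Gamma_verts r m" and x': "x' \<in> Gamma_verts r m"
  shows "(l, x, x') \<in> skel r m \<longleftrightarrow> cskel l (nu x) (nu x')"
proof
  assume "cskel l (nu x) (nu x')"
  then obtain i k u v where *: "1 \<le> i" "i \<le> nstr r m" "l = k + 2 * (sstart r m i - 1)"
    "(k, u, v) \<in> Gt_edges (slen r m i)" "{nu (i, u), nu (i, v)} = {nu x, nu x'}"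
    by (rule cskel_piece)
  have in_verts: "glue r m i u \<in> Gamma_verts r m" "glue r m i v \<in> Gamma_verts r m"
    using Gt_edge_cskel(2,3)[OF *(1,2,4)] glue_in[OF *(1,2)] by auto
  have eq: "glue r m i w = y" if "w \<in> {u, v}" "y \<in> {x, x'}" "nu (i, w) = nu y" for w y
    using that in_verts x x' by (intro inj_onD[OF nu_inj]) (auto simp: nu_glue[OF *(1,2)])
  from *(5) have "glue r m i u = x \<and> glue r m i v = x' \<or> glue r m i v = x \<and> glue r m i u = x'"
    unfolding doubleton_eq_iff using eq by blast
  then show "(l, x, x') \<in> skel r m" using *(1-4) unfolding skel_def by blast
qed (rule skel_cskel)

section \<open>Distance from the root in the skeleton\<close>

primrec hb :: "nat \<Rightarrow> nat" where
  "hb 0 = 0"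
| "hb (Suc n) = hb n + (if asc (Suc n) then 2 else 1)"

text \<open>The distance from the root \<open>Q 1\<close>. An ascent adds two to \<open>hb\<close>
  because the way up passes through both \<open>Q n\<close> and \<open>B n\<close>; elsewhere
  \<open>Q n\<close> with \<open>n > 1\<close> hangs one above \<open>B n\<close>.\<close>

fun height :: "cvert \<Rightarrow> nat" where
  "height (B n) = hb n"
| "height (Q n) = (if n = 1 then 0 else if asc n then hb n - 1 else hb n + 1)"

lemma hb_ge: "n \<le> hb n" and hb_le: "hb n \<le> 2 * n"
  by (induction n) auto

lemma height_arrival: "height (arrival (Suc n)) = Suc (hb n)"
  by (auto simp: arrival_def asc_def)

lemma cskel_cases:
  assumes "cskel l c c'"
  obtains n where "n \<in> {1..r + 1}" "l = 2 * n - 1" "c = Q n" "c' = B n"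
  | n where "n \<in> {1..r + 1}" "l = 2 * n - 1" "c = B n" "c' = Q n"
  | n where "n \<in> {1..r}" "l = 2 * n" "c = B n" "c' = arrival (Suc n)"
  | n where "n \<in> {1..r}" "l = 2 * n" "c = arrival (Suc n)" "c' = B n"
  using assms unfolding cskel_def doubleton_eq_iff by blast

lemma cskel_height:
  assumes "cskel l c c'"
  shows "height c' = Suc (height c) \<or> height c = Suc (height c')"
proof -
  have *: "height (Q n) = Suc (height (B n)) \<or> height (B n) = Suc (height (Q n))"
    if "n \<in> {1..r + 1}" for n
  proof (cases "n = 1")
    case True
    then show ?thesis by (simp add: not_asc_1)
  next
    case False
    then show ?thesis using hb_ge[of n] that by auto
  qed
  from assms show ?thesis
    by (cases rule: cskel_cases) (use * in \<open>auto simp: height_arrival simp del: height.simps(2)\<close>)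
qed

lemma height_pred:
  assumes c: "c \<in> cverts" and k: "height c = Suc k"
  obtains l c' where "c' \<in> cverts" "cskel l c' c" "height c' = k"
proof (cases c)
  case (B n)
  then have n: "n \<in> {1..r + 1}" using c by (auto simp: cverts_def)
  show thesis
  proof (cases "n = 1 \<or> asc n")
    case True
    then have "height (Q n) = k" using k B by (auto simp: not_asc_1)
    moreover have "cskel (2 * n - 1) (Q n) c" using cskel_odd[OF n] B by simp
    moreover have "Q n \<in> cverts" using n by (simp add: cverts_def)
    ultimately show thesis by (intro that)
  next
    case False
    then obtain j where j: "n = Suc j" "j \<in> {1..r}" using n by (cases n) auto
    then have "arrival (Suc j) = c" using False B by (simp add: arrival_def)
    then have "cskel (2 * j) (B j) c" using cskel_even[OF j(2)] by simp
    moreover have "height (B j) = k" using k B j False by simp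
    moreover have "B j \<in> cverts" using j by (simp add: cverts_def)
    ultimately show thesis by (intro that)
  qed
next
  case (Q n)
  then have n: "n \<in> {1..r + 1}" using c by (auto simp: cverts_def)
  have n1: "n \<noteq> 1" using k Q by auto
  show thesis
  proof (cases "asc n")
    case True
    then obtain j where j: "n = Suc j" "j \<in> {1..r}" using n n1 by (cases n) auto
    then have "arrival (Suc j) = c" using True Q by (simp add: arrival_def)
    then have "cskel (2 * j) (B j) c" using cskel_even[OF j(2)] by simp
    moreover have "height (B j) = k" using k Q j True n1 by simp
    moreover have "B j \<in> cverts" using j by (simp add: cverts_def)
    ultimately show thesis by (intro that)
  next
    case False
    then have "height (B n) = k" using k Q n1 by simp
    moreover have "cskel (2 * n - 1) (B n) c" using cskel_odd[OF n] Q by (simp add: cskel_sym)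
    moreover have "B n \<in> cverts" using n by (simp add: cverts_def)
    ultimately show thesis by (intro that)
  qed
qed

lemma height_0: "c \<in> cverts \<Longrightarrow> height c = 0 \<Longrightarrow> c = Q 1"
proof (cases c)
  case (B n)
  then show "c \<in> cverts \<Longrightarrow> height c = 0 \<Longrightarrow> c = Q 1" using hb_ge[of n] by (auto simp: cverts_def)
next
  case (Q n)
  then show "c \<in> cverts \<Longrightarrow> height c = 0 \<Longrightarrow> c = Q 1"
    using hb_ge[of n] by (auto simp: asc_def split: if_splits)
qed

lemma Gamma_root: "Gamma_root r m \<in> Gamma_verts r m" "nu (Gamma_root r m) = Q 1"
  and Gamma_one: "Gamma_one r m \<in> Gamma_verts r m" "nu (Gamma_one r m) = B 1"
  using nstr_pos nu_glue[of 1] nu_0_1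
  by (auto simp: Gamma_root_def Gamma_one_def Gt_verts_def simp del: nu.simps intro!: glue_in)

text \<open>By \<open>height_pred\<close> one can descend one level at a time to the only vertex of
  height \<open>0\<close>, the root; by \<open>cskel_height\<close> no walk is faster.\<close>

lemma root_dist_eq:
  assumes x: "x \<in> Gamma_verts r m"
  shows "root_dist r m x = height (nu x)"
  unfolding root_dist_def
proof (rule Least_equality)
  show "(Gamma_root r m, x) \<in> skel_adj r m ^^ height (nu x)"
    using x
  proof (induction "height (nu x)" arbitrary: x)
    case 0
    then have "nu x = Q 1" using height_0 nu_bij by (metis bij_betwE)
    then have "x = Gamma_root r m" using 0 Gamma_root inj_onD[OF nu_inj] by metis
    show ?case unfolding \<open>x = Gamma_root r m\<close> Gamma_root(2) by simp
  next
    case (Suc k)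
    have "nu x \<in> cverts" using Suc.prems nu_bij by (metis bij_betwE)
    then obtain l c where c: "c \<in> cverts" "cskel l c (nu x)" "height c = k"
      using Suc.hyps(2)[symmetric] by (rule height_pred)
    then obtain u where u: "u \<in> Gamma_verts r m" "c = nu u"
      using nu_bij by (metis bij_betw_imp_surj_on imageE)
    then have "(u, x) \<in> skel_adj r m"
      using c skel_iff[OF u(1) Suc.prems] by (auto simp: skel_adj_def)
    moreover have "(Gamma_root r m, u) \<in> skel_adj r m ^^ k" using Suc.hyps(1)[of u] u c by simp
    ultimately have "(Gamma_root r m, x) \<in> skel_adj r m ^^ Suc k" by auto
    with Suc.hyps(2) show ?case by simp
  qed
next
  fix n assume "(Gamma_root r m, x) \<in> skel_adj r m ^^ n"
  then show "height (nu x) \<le> n"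
  proof (induction n arbitrary: x)
    case 0
    then have "x = Gamma_root r m" by simp
    show ?case unfolding \<open>x = Gamma_root r m\<close> Gamma_root(2) by simp
  next
    case (Suc n)
    then obtain u l where u: "(Gamma_root r m, u) \<in> skel_adj r m ^^ n" "(l, u, x) \<in> skel r m"
      by (auto simp: skel_adj_def)
    from cskel_height[OF skel_cskel(1)[OF u(2)]] Suc.IH[OF u(1)] show ?case by linarith
  qed
qed

section \<open>Edge weights of \<Gamma>_m in the uniform numbering\<close>

lemma extra_edge_iff:
  assumes x: "x \<in> Gamma_verts r m" and x': "x' \<in> Gamma_verts r m"
  shows "(\<exists>i a b. x = glue r m i (V a) \<and> w = fps_X * fps_const
           ((\<Prod>c\<in>{b..<a}. y (2 * c + 2 * (sstart r m i - 1)))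
            / (\<Prod>c\<in>{b<..<a}. y (2 * c - 1 + 2 * (sstart r m i - 1)))) \<and>
         x' = glue r m i (V b) \<and> 1 \<le> i \<and> i \<le> nstr r m \<and> 1 \<le> b \<and> b + 2 \<le> a \<and> a \<le> slen r m i + 1)
     \<longleftrightarrow> (\<exists>n n'. nu x = arrival n \<and> nu x' = B n' \<and> desc_run n n' \<and> w = desc_wt n n')"
    (is "?L \<longleftrightarrow> ?R")
proof -
  \<comment> \<open>Positions inside a piece that starts at \<open>s\<close> are shifted by
    \<open>s - 1\<close>.\<close>
  have wt: "fps_X * fps_const ((\<Prod>c\<in>{b..<a}. y (2 * c + 2 * (s - 1)))
            / (\<Prod>c\<in>{b<..<a}. y (2 * c - 1 + 2 * (s - 1)))) = desc_wt (s + a - 1) (s + b - 1)"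
    if s: "1 \<le> s" and b: "1 \<le> b" for a b s
  proof -
    have "(\<Prod>c\<in>{b..<a}. y (2 * c + 2 * (s - 1))) = (\<Prod>j\<in>{s + b - 1..<s + a - 1}. y (2 * j))"
      by (rule prod.reindex_bij_witness[of _ "\<lambda>j. j - (s - 1)" "\<lambda>c. c + (s - 1)"])
         (use s b in \<open>auto simp: algebra_simps\<close>)
    moreover have "(\<Prod>c\<in>{b<..<a}. y (2 * c - 1 + 2 * (s - 1)))
        = (\<Prod>j\<in>{s + b - 1<..<s + a - 1}. y (2 * j - 1))"
      by (rule prod.reindex_bij_witness[of _ "\<lambda>j. j - (s - 1)" "\<lambda>c. c + (s - 1)"])
         (use s b in \<open>auto simp: algebra_simps\<close>)
    ultimately show ?thesis by simp
  qed
  show ?thesis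
  proof
    assume ?L
    then obtain i a b where *: "x = glue r m i (V a)" "x' = glue r m i (V b)" "1 \<le> i" "i \<le> nstr r m"
      "1 \<le> b" "b + 2 \<le> a" "a \<le> slen r m i + 1"
      and w: "w = fps_X * fps_const ((\<Prod>c\<in>{b..<a}. y (2 * c + 2 * (sstart r m i - 1)))
            / (\<Prod>c\<in>{b<..<a}. y (2 * c - 1 + 2 * (sstart r m i - 1))))"
      by blast
    let ?n = "sstart r m i + a - 1" and ?n' = "sstart r m i + b - 1"
    have s: "1 \<le> sstart r m i" "sstart r m (Suc i) = sstart r m i + slen r m i"
      "sstart r m (Suc i) \<le> Suc r"
      using sstart_bounds[of i] sstart_bounds[of "Suc i"] sstart_Suc[of i] * by auto
    have "nu x = arrival ?n" "nu x' = B ?n'"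
      using nu_glue[OF *(3,4)] nu_V_arrival[OF *(3,4), of a] nu_V[of b i] * by auto
    moreover have "desc_run ?n ?n'"
      using * s sstart_between[OF *(3,4)] by (auto simp: desc_run_def)
    moreover have "w = desc_wt ?n ?n'" unfolding w by (rule wt[OF s(1) *(5)])
    ultimately show ?R by blast
  next
    assume ?R
    then obtain n n' where *: "nu x = arrival n" "nu x' = B n'" "desc_run n n'"
      and w: "w = desc_wt n n'" by blast
    have n: "1 \<le> n'" "n' + 2 \<le> n" "n \<le> r + 1" "\<forall>l\<in>{n'<..<n}. desc l"
      using *(3) by (auto simp: desc_run_def)
    then have "n' \<in> {1..r}" by auto
    then obtain i where i: "1 \<le> i" "i \<le> nstr r m" "sstart r m i \<le> n'" "n' < sstart r m (Suc i)"
      by (rule string_of)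
    \<comment> \<open>A run may end at the next string start but not beyond it, as that start would
      then be a descent.\<close>
    have "n \<le> sstart r m (Suc i)"
    proof (rule ccontr)
      assume lt: "\<not> n \<le> sstart r m (Suc i)"
      with n i have "desc (sstart r m (Suc i))" by auto
      moreover from lt n have "i \<noteq> nstr r m" using sstart_last by auto
      ultimately show False using sstart_in[of "Suc i"] i by auto
    qed
    moreover define a where "a = n - sstart r m i + 1"
    moreover define b where "b = n' - sstart r m i + 1"
    ultimately have ab: "1 \<le> b" "b + 2 \<le> a" "a \<le> slen r m i + 1"
      "n = sstart r m i + a - 1" "n' = sstart r m i + b - 1"
      using sstart_Suc[OF i(1,2)] n i by auto
    have "nu (i, V a) = nu x" "nu (i, V b) = nu x'"
      using nu_V_arrival[OF i(1,2), of a] nu_V[of b i] ab * by auto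
    moreover have "glue r m i (V a) \<in> Gamma_verts r m" "glue r m i (V b) \<in> Gamma_verts r m"
      using glue_in[OF i(1,2)] ab by (auto simp: Gt_verts_def)
    ultimately have "x = glue r m i (V a)" "x' = glue r m i (V b)"
      using x x' nu_glue[OF i(1,2)] inj_onD[OF nu_inj] by metis+
    moreover have "1 \<le> sstart r m i" using sstart_bounds[of i] i by auto
    note w[unfolded ab(4,5) wt[OF this ab(1), symmetric]]
    ultimately show ?L using i(1,2) ab(1-3) by blast
  qed
qed

lemma Gamma_edges_iff:
  assumes x: "x \<in> Gamma_verts r m" and x': "x' \<in> Gamma_verts r m"
  shows "(x, w, x') \<in> Gamma_edges r m y \<longleftrightarrow>
    (\<exists>l. cskel l (nu x) (nu x') \<and>
       (w = wt l \<and> height (nu x') < height (nu x) \<or> w = 1 \<and> height (nu x) < height (nu x'))) \<or>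
    (\<exists>n n'. nu x = arrival n \<and> nu x' = B n' \<and> desc_run n n' \<and> w = desc_wt n n')"
  unfolding extra_edge_iff[OF x x', symmetric] skel_iff[OF x x', symmetric]
    root_dist_eq[OF x, symmetric] root_dist_eq[OF x', symmetric] Gamma_edges_def Un_iff mem_Collect_eq
    prod.inject
  by blast

lemma Gamma_edges_in:
  assumes "(x, w, x') \<in> Gamma_edges r m y"
  shows "x \<in> Gamma_verts r m \<and> x' \<in> Gamma_verts r m"
proof -
  have "glue r m i (V a) \<in> Gamma_verts r m"
    if "1 \<le> i" "i \<le> nstr r m" "a \<le> slen r m i + 1" for i a
    using that by (intro glue_in) (auto simp: Gt_verts_def)
  then show ?thesis using assms skel_cskel(2,3) unfolding Gamma_edges_def by fastforce
qed

lemma swt_cskel: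
  assumes "cskel l c c'"
  shows "swt c c' = (if height c' < height c then wt l else 1)"
  using assms
proof (cases rule: cskel_cases)
  case (1 n)
  then show ?thesis using hb_ge[of n] not_asc_1 by auto
next
  case (2 n)
  then show ?thesis using hb_ge[of n] not_asc_1 by auto
next
  case (3 n)
  then show ?thesis by (auto simp: height_arrival simp del: height.simps(2) hb.simps) (auto simp: arrival_def)
next
  case (4 n)
  then show ?thesis by (auto simp: height_arrival simp del: height.simps(2) hb.simps) (auto simp: arrival_def down_Suc)
qed

lemma swt_run: "desc_run n n' \<Longrightarrow> swt (arrival n) (B n') = desc_wt n n'"
  by (auto simp: desc_run_def arrival_def down_def)

text \<open>Supplies the second premise of \<open>edge_wt_eqI\<close>: a nonzero \<open>down\<close>
  is an even skeleton edge when the gap is one and an additional edge otherwise.\<close>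

lemma swt_nonzero:
  assumes c: "c \<in> cverts" and c': "c' \<in> cverts" and nz: "swt c c' \<noteq> 0"
  shows "(\<exists>l. cskel l c c') \<or> (\<exists>n n'. c = arrival n \<and> c' = B n' \<and> desc_run n n')"
proof -
  have down: ?thesis
    if "c = arrival n" "c' = B n'" "down n n' \<noteq> 0" "1 \<le> n'" "n' < n" "n \<le> r + 1" for n n'
  proof (cases "n = Suc n'")
    case True
    with that cskel_even[of n'] show ?thesis by (auto simp: cskel_sym)
  next
    case False
    with that show ?thesis by (auto simp: down_def desc_run_def split: if_splits)
  qed
  show ?thesis
  proof (cases c)
    case (B n)
    then have n: "n \<in> {1..r + 1}" using c by (auto simp: cverts_def)
    show ?thesis
    proof (cases c')
      case (B n')
      with \<open>c = B n\<close> nz c' consider "n' = Suc n" "\<not> asc n'" | "n' < n" "\<not> asc n" "down n n' \<noteq> 0"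
        by (auto split: if_splits)
      then show ?thesis
      proof cases
        case 1
        with B c' n cskel_even[of n] show ?thesis by (auto simp: \<open>c = B n\<close> cverts_def arrival_def)
      next
        case 2
        with B c' n show ?thesis
          by (intro down[of n n']) (auto simp: \<open>c = B n\<close> cverts_def arrival_def)
      qed
    next
      case (Q n')
      with \<open>c = B n\<close> nz c' consider "n' = n" | "n' = Suc n" "asc n'"
        by (auto split: if_splits)
      then show ?thesis
      proof cases
        case 1
        with Q n cskel_odd[of n] show ?thesis by (auto simp: \<open>c = B n\<close> cskel_sym)
      next
        case 2
        with Q c' n cskel_even[of n] show ?thesis by (auto simp: \<open>c = B n\<close> cverts_def arrival_def)
      qed
    qed
  next
    case (Q n)
    then have n: "n \<in> {1..r + 1}" using c by (auto simp: cverts_def)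
    show ?thesis
    proof (cases c')
      case (B n')
      with Q nz c' consider "n' = n" | "n' < n" "asc n" "down n n' \<noteq> 0"
        by (auto split: if_splits)
      then show ?thesis
      proof cases
        case 1
        with Q B n cskel_odd[of n] show ?thesis by auto
      next
        case 2
        with Q B c' n show ?thesis
          by (intro down[of n n']) (auto simp: cverts_def arrival_def)
      qed
    qed (use Q nz in auto)
  qed
qed

text \<open>Only edges of weight \<open>1\<close> have a constant term, and these point away from
  the root; so \<open>height\<close> serves as the rank.\<close>

lemma swt_nth_0:
  assumes c: "c \<in> cverts" and c': "c' \<in> cverts" and nz: "fps_nth (swt c c') 0 \<noteq> 0"
  shows "height c < height c'"
proof -
  have "swt c c' \<noteq> 0" using nz by auto
  from swt_nonzero[OF c c' this] show ?thesis
  proof (elim disjE exE conjE)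
    fix l assume l: "cskel l c c'"
    then have "\<not> height c' < height c" using nz swt_cskel[OF l] by auto
    with cskel_height[OF l] show ?thesis by auto
  next
    fix n n' assume "c = arrival n" "c' = B n'" "desc_run n n'"
    with nz swt_run[of n n'] show ?thesis by (simp del: swt.simps)
  qed
qed

lemma edge_wt_Gamma:
  assumes x: "x \<in> Gamma_verts r m" and x': "x' \<in> Gamma_verts r m"
  shows "edge_wt (Gamma_edges r m y) x x' = swt (nu x) (nu x')"
proof (rule edge_wt_eqI)
  fix w assume "(x, w, x') \<in> Gamma_edges r m y"
  then show "w = swt (nu x) (nu x')"
    unfolding Gamma_edges_iff[OF x x']
  proof (elim disjE exE conjE)
    fix n n' assume "nu x = arrival n" "nu x' = B n'" "desc_run n n'" "w = desc_wt n n'"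
    then show ?thesis using swt_run[of n n'] by (simp only:)
  qed (auto simp: swt_cskel)
next
  assume nz: "swt (nu x) (nu x') \<noteq> 0"
  have "nu x \<in> cverts" "nu x' \<in> cverts" using x x' nu_bij bij_betwE by metis+
  from swt_nonzero[OF this nz]
  consider l where "cskel l (nu x) (nu x')"
    | n n' where "nu x = arrival n" "nu x' = B n'" "desc_run n n'" by blast
  then show "(x, swt (nu x) (nu x'), x') \<in> Gamma_edges r m y"
  proof cases
    case (1 l)
    have "swt (nu x) (nu x') = wt l \<and> height (nu x') < height (nu x) \<or>
        swt (nu x) (nu x') = 1 \<and> height (nu x) < height (nu x')"
      using cskel_height[OF 1] swt_cskel[OF 1] by auto
    with 1 show ?thesis unfolding Gamma_edges_iff[OF x x'] by blast
  next
    case (2 n n')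
    then have "swt (nu x) (nu x') = desc_wt n n'" using swt_run by (simp only:)
    with 2 show ?thesis unfolding Gamma_edges_iff[OF x x'] by blast
  qed
qed

section \<open>Comparison of the two partition functions\<close>

sublocale Gamma: graded_graph "Gamma_verts r m" "Gamma_edges r m y" "\<lambda>x. height (nu x)" "2 * r + 3"
proof
  show "finite (Gamma_verts r m)" using nu_bij finite_cverts bij_betw_finite by metis
next
  fix u v assume nz: "fps_nth (edge_wt (Gamma_edges r m y) u v) 0 \<noteq> 0"
  then have "\<exists>w. (u, w, v) \<in> Gamma_edges r m y" by (auto simp: edge_wt_def split: if_splits)
  then have uv: "u \<in> Gamma_verts r m" "v \<in> Gamma_verts r m" using Gamma_edges_in by blast+
  then have "nu u \<in> cverts" "nu v \<in> cverts" using nu_bij bij_betwE by metis+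
  with nz show "height (nu u) < height (nu v)" unfolding edge_wt_Gamma[OF uv] by (rule swt_nth_0[rotated 2])
next
  fix v assume "v \<in> Gamma_verts r m"
  then have "nu v \<in> cverts" using nu_bij bij_betwE by metis
  then obtain n where "n \<le> r + 1" "nu v = B n \<or> nu v = Q n" by (auto simp: cverts_def)
  \<comment> \<open>\<open>hb\<close> is at most \<open>2 * (r + 1)\<close>, and a pendant vertex is
    one higher.\<close>
  with hb_le[of n] show "height (nu v) \<le> 2 * r + 3" by auto
qed (use Gamma_edges_in in blast)

sublocale Gamma': graded_graph "{1..r + 1}" "Gamma'_edges r m y" "\<lambda>n. n" "r + 1"
proof
  fix n n' assume nz: "fps_nth (edge_wt (Gamma'_edges r m y) n n') 0 \<noteq> 0"
  then have "\<exists>w. (n, w, n') \<in> Gamma'_edges r m y" by (auto simp: edge_wt_def split: if_splits)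
  then have n: "n \<in> {1..r + 1}" "n' \<in> {1..r + 1}" unfolding Gamma'_edges_iff by blast+
  \<comment> \<open>Loops and downward edges carry a factor \<open>t\<close>, so the vertex number
    is a rank.\<close>
  show "n < n'"
    using nz unfolding edge_wt_Gamma'[OF n]
    by (cases n n' rule: linorder_cases) (auto simp: cwt_def down_def split: if_splits)
qed (auto simp: Gamma'_edges_iff)

text \<open>The lift of the column of \<open>Gamma'.G\<close> at \<open>1\<close> solves the
  equations on \<Gamma>_m, whose solution is unique.\<close>

lemma G_Gamma_eq: "Gamma.G (Gamma_one r m) (Gamma_one r m) = Gamma'.G 1 1"
proof -
  define z where "z = lift (\<lambda>n. Gamma'.G n 1)"
  have one: "1 \<in> {1..r + 1}" by simp
  have z: "z c = (if c = B 1 then 1 else 0) + (\<Sum>c'\<in>cverts. swt c c' * z c')" if "c \<in> cverts" for c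
    unfolding z_def
  proof (rule lift_harmonic[OF _ that])
    fix n assume n: "n \<in> {1..r + 1}"
    show "Gamma'.G n 1 = (if n = 1 then 1 else 0) + (\<Sum>n'\<in>{1..r + 1}. cwt n n' * Gamma'.G n' 1)"
      by (subst Gamma'.G_left[OF n])
         (intro arg_cong2[where f = "(+)"] sum.cong refl, simp only: edge_wt_Gamma'[OF n])
  qed
  have "Gamma.G (Gamma_one r m) (Gamma_one r m) = (\<lambda>x. z (nu x)) (Gamma_one r m)"
  proof (rule Gamma.G_unique[OF Gamma_one(1) Gamma_one(1)])
    fix x assume x: "x \<in> Gamma_verts r m"
    then have "nu x \<in> cverts" using nu_bij bij_betwE by metis
    from z[OF this] have "z (nu x) = (if nu x = B 1 then 1 else 0)
        + (\<Sum>v\<in>Gamma_verts r m. swt (nu x) (nu v) * z (nu v))"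
      by (simp only: sum.reindex_bij_betw[OF nu_bij, of "\<lambda>c. swt (nu x) c * z c"])
    also have "(nu x = B 1) = (x = Gamma_one r m)"
      using Gamma_one x inj_onD[OF nu_inj] by metis
    also have "(\<Sum>v\<in>Gamma_verts r m. swt (nu x) (nu v) * z (nu v))
        = (\<Sum>v\<in>Gamma_verts r m. edge_wt (Gamma_edges r m y) x v * z (nu v))"
      by (intro sum.cong refl) (simp only: edge_wt_Gamma[OF x])
    finally show "z (nu x) = (if x = Gamma_one r m then 1 else 0)
        + (\<Sum>v\<in>Gamma_verts r m. edge_wt (Gamma_edges r m y) x v * z (nu v))" .
  qed
  \<comment> \<open>Since \<open>1\<close> is no ascent, \<open>tau 1 = 1\<close> and the value at
    \<open>B 1\<close> is not rescaled.\<close>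
  also have "\<dots> = Gamma'.G 1 1"
    by (simp add: Gamma_one(2) z_def not_asc_1)
  finally show ?thesis .
qed

end

theorem theorem6p1:
  fixes r :: nat and m :: "nat \<Rightarrow> int"
    and R :: "nat \<Rightarrow> int \<Rightarrow> 'k::field_char_0 ratfun"
    and y :: "nat \<Rightarrow> 'k ratfun"
    and vs :: "(nat \<times> gvert) list" and e :: nat
    and E :: "(nat \<times> gvert, 'k ratfun fps) wedges" and E' :: "(nat, 'k ratfun fps) wedges"
    and T T' :: "'k ratfun fps mat"
  assumes "1 \<le> r" and "motzkin r m" and "Q_system r R"
  defines "y \<equiv> y_wt R m"
  defines "E \<equiv> Gamma_edges r m y" and "E' \<equiv> Gamma'_edges r m y"
  \<comment> \<open>an arbitrary ordering of the vertices of \<open>\<Gamma>\<^sub>m\<close>, with vertex \<open>1\<close> at position \<open>e\<close>\<close>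
  assumes "distinct vs" and "set vs = Gamma_verts r m"
    and "e < length vs" and "vs ! e = Gamma_one r m"
  defines "T \<equiv> transfer_mat vs E" and "T' \<equiv> transfer_mat [1..<r + 2] E'"
  shows "invertible_mat (1\<^sub>m (dim_row T) - T) \<and> invertible_mat (1\<^sub>m (dim_row T') - T') \<and>
    resolvent T $$ (e, e) = resolvent T' $$ (0, 0) \<and>
    (path_wt E has_sum resolvent T $$ (e, e)) (paths E (Gamma_one r m) (Gamma_one r m)) \<and>
    (path_wt E' has_sum resolvent T' $$ (0, 0)) (paths E' 1 1)"
proof -
  interpret motzkin_steps r m y
    by standard (use assms(1,2) in \<open>auto simp: motzkin_def\<close>)
  \<comment> \<open>Vertex \<open>1\<close> stands at position \<open>0\<close> of this list, hence
    the entry \<open>(0, 0)\<close>.\<close>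
  have vs': "distinct [1..<r + 2]" "set [1..<r + 2] = {1..r + 1}"
    "0 < length [1..<r + 2]" "[1..<r + 2] ! 0 = 1"
    by (auto simp del: upt_Suc)
  have "resolvent T $$ (e, e) = Gamma.G (Gamma_one r m) (Gamma_one r m)"
    using Gamma.resolvent_G(2)[OF assms(7,8,9,9)] assms(10) by (simp add: T_def E_def)
  moreover have "resolvent T' $$ (0, 0) = Gamma'.G 1 1"
    using Gamma'.resolvent_G(2)[OF vs'(1,2,3,3)] vs'(4) by (simp add: T'_def E'_def del: upt_Suc)
  moreover have "invertible_mat (1\<^sub>m (dim_row T) - T)"
    using Gamma.resolvent_G(1)[OF assms(7,8)] by (simp add: T_def E_def)
  moreover have "invertible_mat (1\<^sub>m (dim_row T') - T')"
    using Gamma'.resolvent_G(1)[OF vs'(1,2)] by (simp add: T'_def E'_def del: upt_Suc)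
  ultimately show ?thesis
    using G_Gamma_eq Gamma.has_sum_paths[OF Gamma_one(1), of "Gamma_one r m"]
      Gamma'.has_sum_paths[of 1 1]
    by (simp add: E_def E'_def)
qed

end
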